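(* Let $\Sigma$: $\dot x=f(x)$ be a dynamical system on an $n$-dimensional manifold $\mathcal{X}$. Suppose that $\Sigma$ admits a set of Koopman eigenfunctions $\phi_{\lambda_j}\in C^1(\mathcal{X})$ with eigenvalues $\lambda_j\in\mathbb{C}$, $j=1,\dots,n$, such that $\Re\{\lambda_1\}>\Re\{\lambda_j\}$ for all $j\geq 2$, such that the linear map $\partial\Phi(x):T_x\mathcal{X}\to\mathbb{C}^n$, $\partial\Phi(x)\delta x=(\partial\phi_{\lambda_1}(x)\delta x,\dots,\partial\phi_{\lambda_n}(x)\delta x)$, is injective for all $x\in\mathcal{X}$, and such that one of the following holds: 1) $\lambda_1\in\mathbb{R}$ (with $\phi_{\lambda_1}$ real-valued), in which case set $\mathcal{K}(x)=\{\delta x\in T_x\mathcal{X}:\partial\phi_{\lambda_1}(x)\delta x-|\partial\phi_{\lambda_j}(x)\delta x|\geq 0\ \forall j\geq 2\}$; 2) $\lambda_1\in i\mathbb{R}$, $\angle\phi_{\lambda_1}\in C^1(\mathcal{X})$ and $|\phi_{\lambda_1}|$ is constant on $\mathcal{X}$, in which case set $\mathcal{K}(x)=\{\delta x\in T_x\mathcal{X}:\partial\angle\phi_{\lambda_1}(x)\delta x-|\partial\phi_{\lambda_j}(x)\delta x|\geq 0\ \forall j\geq 2\}$. (That is, $\Sigma$ is strictly differentially positive, with respect to $\mathcal{K}$.) Then the Perron-Frobenius vector field is the unique vector field $\mathbf{w}$ on $\mathcal{X}$, $\mathbf{w}(x)\in T_x\mathcal{X}$, with $|\mathbf{w}(\cdot)|=1$,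 that satisfies $$\partial\phi_{\lambda_j}(x)[\mathbf{w}(x)]=0\qquad\text{for all } j\geq 2 \text{ and all } x\in\mathcal{X}.$$
   Context: Setting. $\mathcal{X}$ is a smooth $n$-dimensional manifold with a Riemannian metric $\langle\cdot,\cdot\rangle_x$, and $|\delta x|=\sqrt{\langle\delta x,\delta x\rangle_x}$ for $\delta x\in T_x\mathcal{X}$. The system $\Sigma$ is $\dot x=f(x)$ with $f$ a vector field of class $C^2$ on $\mathcal{X}$, forward and backward complete, so that its flow $\psi:\mathbb{R}\times\mathcal{X}\to\mathcal{X}$, $\psi^t(\cdot)=\psi(t,\cdot)$, is defined for all $t\in\mathbb{R}$. For a differentiable map $g$, $\partial g(x)\delta x=\partial g(x)[\delta x]$ is its differential at $x$ applied to $\delta x\in T_x\mathcal{X}$, and $\partial g(x)A=\{\partial g(x)\delta x:\delta x\in A\}$ for $A\subseteq T_x\mathcal{X}$. Koopman eigenfunctions. The Koopman operators act on observables $g:\mathcal{X}\to\mathbb{C}$ by $U^tg=g\circ\psi^t$, $t\in\mathbb{R}$. An observable $\phi_\lambda$ is a Koopman eigenfunction with eigenvalue $\lambda\in\mathbb{C}$ if $\phi_\lambda(\psi^t(x))=e^{\lambda t}\phi_\lambda(x)$ for all $x\in\mathcal{X}$ (and all $t$). $\angle\phi_{\lambda_1}$ denotes the argument of $\phi_{\lambda_1}$ (so $\phi_{\lambda_1}=|\phi_{\lambda_1}|e^{i\angle\phi_{\lambda_1}}$), regarded as taking values in the circle $\mathbb{S}^1=\mathbb{R}/2\pi\mathbb{Z}$;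 its differential is real-valued. Cone fields. A cone field assigns to each $x\in\mathcal{X}$ a closed, solid (nonempty interior) set $\mathcal{K}(x)\subseteq T_x\mathcal{X}$ with $\mathcal{K}(x)+\mathcal{K}(x)\subseteq\mathcal{K}(x)$, $\alpha\mathcal{K}(x)\subseteq\mathcal{K}(x)$ for all $\alpha\in\mathbb{R}^+$, and $\mathcal{K}(x)\cap-\mathcal{K}(x)=\{0\}$. Differential positivity. $\Sigma$ is differentially positive (with respect to $\mathcal{K}$) if $\partial\psi^t(x)\mathcal{K}(x)\subseteq\mathcal{K}(\psi^t(x))$ for all $x\in\mathcal{X}$ and $t>0$. It is (uniformly) strictly differentially positive if in addition there exist a constant $T>0$ and a cone field $\mathcal{R}(x)\subset\mathrm{int}\,\mathcal{K}(x)\cup\{0\}$ such that $\partial\psi^t(x)\mathcal{K}(x)\subseteq\mathcal{R}(\psi^t(x))$ for all $x\in\mathcal{X}$ and $t\geq T$. Standing conventions on cone fields: to avoid pathological cases, it is assumed that for every $x_1,x_2\in\mathcal{X}$ there is a linear invertible map $\Gamma(x_1,x_2):T_{x_1}\mathcal{X}\to T_{x_2}\mathcal{X}$ with $\Gamma(x_1,x_2)\mathcal{K}(x_1)=\mathcal{K}(x_2)$ and $\Gamma(x_1,x_2)\mathcal{R}(x_1)=\mathcal{R}(x_2)$; and one considers representations $\mathcal{K}(x)=\{\delta x\in T_x\mathcal{X}: k_i(x,\delta x)\geq 0,\ i=1,\dots,m\}$, $\mathcal{R}(x)=\{\delta x\in T_x\mathcal{X}: k_i(x,\delta x/|\delta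 x|)\geq\varepsilon,\ i=1,\dots,m\}$ for some $m\in\mathbb{N}$, $\varepsilon>0$ and smooth functions $k_i:T\mathcal{X}\to\mathbb{R}$. Perron-Frobenius vector field. For a strictly differentially positive system (with respect to $\mathcal{K}$), the Perron-Frobenius vector field $\mathbf{w}$, $\mathbf{w}(x)\in\mathrm{int}\,\mathcal{K}(x)$, is defined by $$\mathbf{w}(x)=\lim_{t\to\infty}\frac{\partial\psi^t(\psi^{-t}(x))\delta x}{|\partial\psi^t(\psi^{-t}(x))\delta x|}$$ for all $x\in\mathcal{X}$ and $\delta x\in\mathcal{K}(\psi^{-t}(x))\setminus\{0\}$; for strictly differentially positive systems this limit exists and is independent of the choice of $\delta x$ (known from earlier work).
   Formalization: Since −w satisfies the same conditions as w, uniqueness is proved among unit fields with values in K(x), and up to sign at each point otherwise; K is assumed to be a cone field (it can fail to be one, e.g. if n = 1), and strict differential positivity is then proved. *)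

theory Defs
  imports "HOL-Analysis.Analysis"
begin

section \<open>Differentiability classes on open subsets of Euclidean space\<close>

text \<open>
  \<open>Ck_on k f S\<close> is meant for open \<open>S\<close>: all iterated partial derivatives of order at most \<open>k\<close>
  exist and are continuous, where derivatives of order below \<open>k\<close> are Frechet differentiable.
\<close>

primrec Ck_on ::
  "nat \<Rightarrow> ('a::euclidean_space \<Rightarrow> 'b::real_normed_vector) \<Rightarrow> 'a set \<Rightarrow> bool" where
  "Ck_on 0 f S \<longleftrightarrow> continuous_on S f"
| "Ck_on (Suc k) f S \<longleftrightarrow>
     (\<forall>x\<in>S. f differentiable (at x)) \<and>
     (\<forall>v. Ck_on k (\<lambda>x. frechet_derivative f (at x) v) S)"

definition smooth_on :: "('a::euclidean_space \<Rightarrow> 'b::real_normed_vector) \<Rightarrow> 'a set \<Rightarrow> bool" where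
  "smooth_on f S \<longleftrightarrow> (\<forall>k. Ck_on k f S)"

section \<open>Smooth manifolds\<close>

text \<open>
  The manifold is a whole Hausdorff second countable type \<open>'m\<close>; its dimension is \<open>CARD('n)\<close>.
  A chart is a domain together with a coordinate map, whose values off the domain are irrelevant.
  The atlas need not be maximal.
\<close>

type_synonym ('m, 'n) chart = "'m set \<times> ('m \<Rightarrow> (real, 'n) vec)"

abbreviation cdom :: "('m, 'n::finite) chart \<Rightarrow> 'm set" where
  "cdom c \<equiv> fst c"

abbreviation cmap :: "('m, 'n::finite) chart \<Rightarrow> 'm \<Rightarrow> real ^ 'n" where
  "cmap c \<equiv> snd c"

definition cinv :: "('m, 'n::finite) chart \<Rightarrow> real ^ 'n \<Rightarrow> 'm" where
  "cinv c = inv_into (cdom c) (cmap c)"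

definition smooth_atlas ::
  "('m::{t2_space, second_countable_topology}, 'n::finite) chart set \<Rightarrow> bool" where
  "smooth_atlas A \<longleftrightarrow>
     (\<forall>c\<in>A. open (cdom c) \<and> open (cmap c ` cdom c) \<and>
        homeomorphism (cdom c) (cmap c ` cdom c) (cmap c) (cinv c)) \<and>
     (\<Union>c\<in>A. cdom c) = UNIV \<and>
     (\<forall>c\<in>A. \<forall>d\<in>A. smooth_on (cmap d \<circ> cinv c) (cmap c ` (cdom c \<inter> cdom d)))"

definition charts_at :: "('m, 'n::finite) chart set \<Rightarrow> 'm \<Rightarrow> ('m, 'n) chart set" where
  "charts_at A x = {c \<in> A. x \<in> cdom c}"

section \<open>Tangent spaces\<close>

text \<open>
  A tangent vector at \<open>x\<close> is the family of its coordinate vectors in all the charts around \<open>x\<close>,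
  which transform into each other by the derivatives of the transition maps; it is extended by
  zero to the other elements of the chart type, so that equality of tangent vectors is equality
  of functions.  Evaluation at any chart around \<open>x\<close> is a bijection from the tangent space onto
  \<open>real ^ 'n\<close>.  The product topology of the function type restricts to the usual topology of
  the finite-dimensional vector space \<open>tangent_space A x\<close>.
\<close>

type_synonym ('m, 'n) tvec = "('m, 'n) chart \<Rightarrow> (real, 'n) vec"

definition transition_deriv ::
  "('m, 'n::finite) chart \<Rightarrow> ('m, 'n) chart \<Rightarrow> 'm \<Rightarrow> real ^ 'n \<Rightarrow> real ^ 'n" where
  "transition_deriv c d x = frechet_derivative (cmap d \<circ> cinv c) (at (cmap c x))"

definition tangent_space :: "('m, 'n::finite) chart set \<Rightarrow> 'm \<Rightarrow> ('m, 'n) tvec set" where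
  "tangent_space A x =
     {v. (\<forall>c. c \<notin> charts_at A x \<longrightarrow> v c = 0) \<and>
         (\<forall>c\<in>charts_at A x. \<forall>d\<in>charts_at A x. v d = transition_deriv c d x (v c))}"

definition tv_zero :: "('m, 'n::finite) tvec" where
  "tv_zero = (\<lambda>c. 0)"

definition tv_add :: "('m, 'n::finite) tvec \<Rightarrow> ('m, 'n) tvec \<Rightarrow> ('m, 'n) tvec" where
  "tv_add u v = (\<lambda>c. u c + v c)"

definition tv_scale :: "real \<Rightarrow> ('m, 'n::finite) tvec \<Rightarrow> ('m, 'n) tvec" where
  "tv_scale a v = (\<lambda>c. a *\<^sub>R v c)"

definition tv_interior ::
  "('m, 'n::finite) chart set \<Rightarrow> 'm \<Rightarrow> ('m, 'n) tvec set \<Rightarrow> ('m, 'n) tvec set" where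
  "tv_interior A x S = (top_of_set (tangent_space A x)) interior_of S"

text \<open>The tangent vector at \<open>x\<close> with coordinates \<open>u\<close> in the chart \<open>c\<close>.\<close>

definition tv_of_coords ::
  "('m, 'n::finite) chart set \<Rightarrow> ('m, 'n) chart \<Rightarrow> 'm \<Rightarrow> real ^ 'n \<Rightarrow> ('m, 'n) tvec" where
  "tv_of_coords A c x u = (\<lambda>d. if d \<in> charts_at A x then transition_deriv c d x u else 0)"

section \<open>Maps and their differentials\<close>

definition Ck_observable ::
  "('m, 'n::finite) chart set \<Rightarrow> nat \<Rightarrow> 'm set \<Rightarrow> ('m \<Rightarrow> 'b::real_normed_vector) \<Rightarrow> bool" where
  "Ck_observable A k U h \<longleftrightarrow> (\<forall>c\<in>A. Ck_on k (h \<circ> cinv c) (cmap c ` (cdom c \<inter> U)))"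

text \<open>
  The two differentials are computed in an arbitrarily chosen chart around \<open>x\<close>; for maps that
  are differentiable at \<open>x\<close> the choice does not matter.
\<close>

definition chart_at :: "('m, 'n::finite) chart set \<Rightarrow> 'm \<Rightarrow> ('m, 'n) chart" where
  "chart_at A x = (SOME c. c \<in> charts_at A x)"

definition differential ::
  "('m, 'n::finite) chart set \<Rightarrow> ('m \<Rightarrow> 'b::real_normed_vector) \<Rightarrow> 'm \<Rightarrow> ('m, 'n) tvec \<Rightarrow> 'b" where
  "differential A h x v =
     (let c = chart_at A x in frechet_derivative (h \<circ> cinv c) (at (cmap c x)) (v c))"

definition tangent_map ::
  "('m, 'n::finite) chart set \<Rightarrow> ('m \<Rightarrow> 'm) \<Rightarrow> 'm \<Rightarrow> ('m, 'n) tvec \<Rightarrow> ('m, 'n) tvec" where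
  "tangent_map A F x v =
     (let c = chart_at A x in
       (\<lambda>d. if d \<in> charts_at A (F x)
            then frechet_derivative (cmap d \<circ> F \<circ> cinv c) (at (cmap c x)) (v c) else 0))"

section \<open>Riemannian metrics\<close>

definition riemannian_metric ::
  "('m, 'n::finite) chart set \<Rightarrow> ('m \<Rightarrow> ('m, 'n) tvec \<Rightarrow> ('m, 'n) tvec \<Rightarrow> real) \<Rightarrow> bool" where
  "riemannian_metric A g \<longleftrightarrow>
     (\<forall>x. \<forall>u\<in>tangent_space A x. \<forall>v\<in>tangent_space A x.
        g x u v = g x v u \<and>
        (\<forall>a. g x (tv_scale a u) v = a * g x u v) \<and>
        (\<forall>u'\<in>tangent_space A x. g x (tv_add u u') v = g x u v + g x u' v) \<and>
        (u \<noteq> tv_zero \<longrightarrow> g x u u > 0)) \<and>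
     (\<forall>c\<in>A. \<forall>u v. smooth_on
        (\<lambda>p. g (cinv c p) (tv_of_coords A c (cinv c p) u) (tv_of_coords A c (cinv c p) v))
        (cmap c ` cdom c))"

definition tv_norm ::
  "('m \<Rightarrow> ('m, 'n) tvec \<Rightarrow> ('m, 'n) tvec \<Rightarrow> real) \<Rightarrow> 'm \<Rightarrow> ('m, 'n::finite) tvec \<Rightarrow> real" where
  "tv_norm g x v = sqrt (g x v v)"

section \<open>Vector fields and flows\<close>

definition vector_field :: "('m, 'n::finite) chart set \<Rightarrow> ('m \<Rightarrow> ('m, 'n) tvec) \<Rightarrow> bool" where
  "vector_field A f \<longleftrightarrow> (\<forall>x. f x \<in> tangent_space A x)"

definition Ck_vector_field ::
  "('m, 'n::finite) chart set \<Rightarrow> nat \<Rightarrow> ('m \<Rightarrow> ('m, 'n) tvec) \<Rightarrow> bool" where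
  "Ck_vector_field A k f \<longleftrightarrow>
     vector_field A f \<and> (\<forall>c\<in>A. Ck_on k (\<lambda>p. f (cinv c p) c) (cmap c ` cdom c))"

text \<open>
  \<open>\<psi> t x\<close> is the point at time \<open>t\<close> of the integral curve of \<open>f\<close> through \<open>x\<close>.  That integral
  curves are defined for all real times is the forward and backward completeness of \<open>f\<close>.
\<close>

definition complete_flow ::
  "('m::topological_space, 'n::finite) chart set \<Rightarrow> ('m \<Rightarrow> ('m, 'n) tvec) \<Rightarrow>
   (real \<Rightarrow> 'm \<Rightarrow> 'm) \<Rightarrow> bool" where
  "complete_flow A f \<psi> \<longleftrightarrow>
     (\<forall>x. \<psi> 0 x = x \<and> continuous_on UNIV (\<lambda>t. \<psi> t x) \<and>
        (\<forall>t. \<forall>c\<in>charts_at A (\<psi> t x).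
           ((\<lambda>s. cmap c (\<psi> s x)) has_vector_derivative f (\<psi> t x) c) (at t)))"

section \<open>Koopman eigenfunctions\<close>

definition koopman :: "(real \<Rightarrow> 'm \<Rightarrow> 'm) \<Rightarrow> real \<Rightarrow> ('m \<Rightarrow> complex) \<Rightarrow> 'm \<Rightarrow> complex" where
  "koopman \<psi> t h = h \<circ> \<psi> t"

definition koopman_eigenfunction ::
  "(real \<Rightarrow> 'm \<Rightarrow> 'm) \<Rightarrow> complex \<Rightarrow> ('m \<Rightarrow> complex) \<Rightarrow> bool" where
  "koopman_eigenfunction \<psi> l \<phi> \<longleftrightarrow>
     (\<forall>t x. koopman \<psi> t \<phi> x = exp (l * of_real t) * \<phi> x)"

text \<open>
  The argument takes values in the circle of reals modulo \<open>2\<pi>\<close>.  It is \<open>C\<^sup>1\<close> if locally it has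
  real-valued \<open>C\<^sup>1\<close> lifts, and its differential is that of any local lift (two lifts differ by a
  locally constant function).
\<close>

definition C1_angle_lift ::
  "('m::topological_space, 'n::finite) chart set \<Rightarrow> ('m \<Rightarrow> complex) \<Rightarrow> 'm set \<Rightarrow>
   ('m \<Rightarrow> real) \<Rightarrow> bool" where
  "C1_angle_lift A \<phi> U \<theta> \<longleftrightarrow>
     open U \<and> Ck_observable A 1 U \<theta> \<and> (\<forall>y\<in>U. \<phi> y = of_real (cmod (\<phi> y)) * cis (\<theta> y))"

definition C1_angle ::
  "('m::topological_space, 'n::finite) chart set \<Rightarrow> ('m \<Rightarrow> complex) \<Rightarrow> bool" where
  "C1_angle A \<phi> \<longleftrightarrow> (\<forall>x. \<phi> x \<noteq> 0) \<and> (\<forall>x. \<exists>U \<theta>. x \<in> U \<and> C1_angle_lift A \<phi> U \<theta>)"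

definition angle_differential ::
  "('m::topological_space, 'n::finite) chart set \<Rightarrow> ('m \<Rightarrow> complex) \<Rightarrow> 'm \<Rightarrow> ('m, 'n) tvec \<Rightarrow> real"
  where
  "angle_differential A \<phi> x v =
     (THE a. \<exists>U \<theta>. x \<in> U \<and> C1_angle_lift A \<phi> U \<theta> \<and> a = differential A \<theta> x v)"

section \<open>Cone fields and differential positivity\<close>

definition cone_field ::
  "('m, 'n::finite) chart set \<Rightarrow> ('m \<Rightarrow> ('m, 'n) tvec set) \<Rightarrow> bool" where
  "cone_field A K \<longleftrightarrow>
     (\<forall>x. K x \<subseteq> tangent_space A x \<and>
        closedin (top_of_set (tangent_space A x)) (K x) \<and>
        tv_interior A x (K x) \<noteq> {} \<and>
        (\<forall>u\<in>K x. \<forall>v\<in>K x. tv_add u v \<in> K x) \<and>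
        (\<forall>a>0. \<forall>v\<in>K x. tv_scale a v \<in> K x) \<and>
        K x \<inter> tv_scale (-1) ` K x = {tv_zero})"

definition differentially_positive ::
  "('m, 'n::finite) chart set \<Rightarrow> (real \<Rightarrow> 'm \<Rightarrow> 'm) \<Rightarrow> ('m \<Rightarrow> ('m, 'n) tvec set) \<Rightarrow> bool" where
  "differentially_positive A \<psi> K \<longleftrightarrow>
     cone_field A K \<and> (\<forall>x. \<forall>t>0. tangent_map A (\<psi> t) x ` K x \<subseteq> K (\<psi> t x))"

definition strictly_differentially_positive ::
  "('m, 'n::finite) chart set \<Rightarrow> (real \<Rightarrow> 'm \<Rightarrow> 'm) \<Rightarrow> ('m \<Rightarrow> ('m, 'n) tvec set) \<Rightarrow> bool" where
  "strictly_differentially_positive A \<psi> K \<longleftrightarrow>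
     differentially_positive A \<psi> K \<and>
     (\<exists>T>0. \<exists>R. cone_field A R \<and>
        (\<forall>x. R x \<subseteq> tv_interior A x (K x) \<union> {tv_zero}) \<and>
        (\<forall>x. \<forall>t\<ge>T. tangent_map A (\<psi> t) x ` K x \<subseteq> R (\<psi> t x)))"

text \<open>
  The defining limit of the Perron-Frobenius vector field starts from nonzero vectors of
  \<open>K (\<psi> (-t) x)\<close>, a set that depends on \<open>t\<close>; hence an initial vector \<open>\<delta> t\<close> is chosen for each
  \<open>t\<close>, and the limit is the same for all choices.
\<close>

definition perron_frobenius_field ::
  "('m, 'n::finite) chart set \<Rightarrow> ('m \<Rightarrow> ('m, 'n) tvec \<Rightarrow> ('m, 'n) tvec \<Rightarrow> real) \<Rightarrow>
   (real \<Rightarrow> 'm \<Rightarrow> 'm) \<Rightarrow> ('m \<Rightarrow> ('m, 'n) tvec set) \<Rightarrow> ('m \<Rightarrow> ('m, 'n) tvec) \<Rightarrow> bool" where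
  "perron_frobenius_field A g \<psi> K w \<longleftrightarrow>
     (\<forall>x. w x \<in> tv_interior A x (K x)) \<and>
     (\<forall>x \<delta>. (\<forall>t>0. \<delta> t \<in> K (\<psi> (-t) x) - {tv_zero}) \<longrightarrow>
        ((\<lambda>t. let u = tangent_map A (\<psi> t) (\<psi> (-t) x) (\<delta> t)
              in tv_scale (1 / tv_norm g x u) u) \<longlongrightarrow> w x) at_top)"

text \<open>
  The cone cut out by the eigenfunctions \<open>\<phi> 1, \<dots>, \<phi> CARD('n)\<close>, where \<open>a x\<close> stands for the
  differential at \<open>x\<close> of either \<open>\<phi> 1\<close> or its argument.
\<close>

definition eigenfunction_cone ::
  "('m, 'n::finite) chart set \<Rightarrow> (nat \<Rightarrow> 'm \<Rightarrow> complex) \<Rightarrow> ('m \<Rightarrow> ('m, 'n) tvec \<Rightarrow> real) \<Rightarrow>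
   'm \<Rightarrow> ('m, 'n) tvec set" where
  "eigenfunction_cone A \<phi> a x =
     {v \<in> tangent_space A x. \<forall>j\<in>{2..CARD('n)}. a x v - cmod (differential A (\<phi> j) x v) \<ge> 0}"

definition unit_annihilated_field ::
  "('m, 'n::finite) chart set \<Rightarrow> ('m \<Rightarrow> ('m, 'n) tvec \<Rightarrow> ('m, 'n) tvec \<Rightarrow> real) \<Rightarrow>
   (nat \<Rightarrow> 'm \<Rightarrow> complex) \<Rightarrow> ('m \<Rightarrow> ('m, 'n) tvec) \<Rightarrow> bool" where
  "unit_annihilated_field A g \<phi> w \<longleftrightarrow>
     vector_field A w \<and> (\<forall>x. tv_norm g x (w x) = 1) \<and>
     (\<forall>x. \<forall>j\<in>{2..CARD('n)}. differential A (\<phi> j) x (w x) = 0)"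

end

theory Submission
  imports Defs
begin

text \<open>
  The eigenfunctions together form a map \<open>\<Phi> = (\<phi> 1, \<dots>, \<phi> CARD('n))\<close> into \<open>complex ^ 'n\<close> that is
  an immersion and turns the flow into a diagonal linear one: \<open>\<Phi> (\<psi> t x)\<close> arises from \<open>\<Phi> x\<close> by
  multiplying the \<open>j\<close>-th entry by \<open>exp (lam j * t)\<close>.  All regularity of the flow is extracted from
  this semiconjugacy.  Since \<open>\<Phi>\<close> is locally injective, an orbit that starts near a given one can
  leave a compact neighbourhood of it only across the frontier, where \<open>\<Phi>\<close> keeps a positive
  distance; so each \<open>\<psi> t\<close> is continuous (\<open>semiconjugate_flow_continuous\<close>).  A continuous map
  whose composition with an immersion is differentiable is itself differentiable
  (\<open>has_derivative_cancel_immersion\<close>).  Finally, two curves with the same image under \<open>\<Phi>\<close> and a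
  common point coincide, which gives the group law (\<open>lifts_agree\<close>, \<open>flow_group\<close>).

  On tangent vectors, \<open>\<phi> j \<circ> \<psi> t = exp (lam j * t) * \<phi> j\<close> says that the tangent map multiplies the
  value of \<open>d (\<phi> j)\<close> by \<open>exp (lam j * t)\<close> (\<open>differential_flow\<close>).  In both cases of the theorem the
  differential of \<open>\<phi> 1\<close> is a real form \<open>a\<close> times a nowhere vanishing function \<open>\<eta>\<close>: \<open>\<eta> = 1\<close> when
  \<open>\<phi> 1\<close> is real, and \<open>\<eta> = \<i> * \<phi> 1\<close>, with \<open>a\<close> the differential of the argument, when \<open>\<phi> 1\<close> has
  constant modulus.  The form \<open>a\<close> is then multiplied by \<open>exp (Re (lam 1) * t)\<close>, whereas the modulus
  of \<open>d (\<phi> j)\<close>, \<open>j \<ge> 2\<close>, is multiplied by \<open>exp (Re (lam j) * t)\<close>.  With a gap \<open>\<mu> > 0\<close> between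
  \<open>Re (lam 1)\<close> and the other real parts, the flow maps \<open>K\<close>, where all \<open>d (\<phi> j)\<close> are at most \<open>a\<close>, into
  the cone where they are at most \<open>exp (- \<mu> * t) * a\<close> (\<open>dominance_cone_flow\<close>).  By injectivity of
  \<open>d \<Phi>\<close> the latter cone, for \<open>t \<ge> 1\<close>, lies in the interior of \<open>K\<close> up to the zero vector: this is
  strict differential positivity.

  Images of nonzero vectors of \<open>K\<close> from time \<open>-t\<close>, scaled to \<open>a = 1\<close>, stay bounded, and their
  \<open>d (\<phi> j)\<close> decay; a limit point is a vector with \<open>a = 1\<close> and \<open>d (\<phi> j) = 0\<close> for \<open>j \<ge> 2\<close>
  (\<open>dominant_vector_exists\<close>).  By injectivity every vector annihilated by these \<open>d (\<phi> j)\<close> is a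
  multiple of it, and the scaled images converge to it at the rate \<open>exp (- \<mu> * t)\<close>
  (\<open>normalized_push_tendsto\<close>).  So the limit that defines the Perron-Frobenius field exists and
  spans the line of annihilated vectors; the norm fixes it up to sign and \<open>K\<close> fixes the sign.
\<close>

section \<open>Continuity of flows semiconjugate to a family of Lipschitz maps\<close>

lemma isCont_iff_tendsto_nhds: "isCont f x \<longleftrightarrow> (f \<longlongrightarrow> f x) (nhds x)"
  unfolding isCont_def by (rule tendsto_at_iff_tendsto_nhds)

lemma isCont_comp: "isCont f x \<Longrightarrow> isCont g (f x) \<Longrightarrow> isCont (g \<circ> f) x"
  unfolding isCont_iff_tendsto_nhds comp_def by (rule filterlim_compose)

text \<open>
  For \<open>y\<close> near \<open>x\<close>, the orbits of \<open>y\<close> and \<open>x\<close> have close images under \<open>\<Phi>\<close>, uniformly on compact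
  time intervals.  If \<open>B\<close> is a compact neighbourhood of the orbit of \<open>x\<close> during a short time on
  which \<open>\<Phi>\<close> is injective, then \<open>\<Phi>\<close> separates the frontier of \<open>B\<close> from that piece of orbit, so the
  orbit of \<open>y\<close> cannot leave \<open>B\<close> if it is there at one moment; within \<open>B\<close>, closeness of the images
  implies closeness of the points.  Hence continuity at \<open>x\<close> of the time maps is a locally constant
  property of the time, and it holds at time \<open>0\<close>.
\<close>
lemma semiconjugate_flow_continuous:
  fixes \<Phi> :: "'x::t2_space \<Rightarrow> 'v::heine_borel" and \<psi> :: "real \<Rightarrow> 'x \<Rightarrow> 'x"
  assumes \<Phi>: "continuous_on UNIV \<Phi>"
    and loc: "\<And>p. \<exists>B. compact B \<and> p \<in> interior B \<and> inj_on \<Phi> B"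
    and zero: "\<And>x. \<psi> 0 x = x"
    and orbit: "\<And>x. continuous_on UNIV (\<lambda>t. \<psi> t x)"
    and conj: "\<And>t x. \<Phi> (\<psi> t x) = D t (\<Phi> x)"
    and equi: "\<And>I. compact I \<Longrightarrow> \<exists>M. \<forall>t\<in>I. \<forall>u v. dist (D t u) (D t v) \<le> M * dist u v"
  shows "isCont (\<psi> t) x"
proof -
  have \<Phi>_near: "\<forall>\<^sub>F y in nhds x. \<forall>s\<in>I. dist (\<Phi> (\<psi> s x)) (\<Phi> (\<psi> s y)) < e"
    if "compact I" "e > 0" for I e
  proof -
    obtain M where M: "\<And>s u v. s \<in> I \<Longrightarrow> dist (D s u) (D s v) \<le> M * dist u v"
      using equi[OF \<open>compact I\<close>] by blast
    have "(\<Phi> \<longlongrightarrow> \<Phi> x) (nhds x)"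
      using \<Phi> by (simp add: continuous_on_eq_continuous_at isCont_iff_tendsto_nhds)
    then have "((\<lambda>y. M * dist (\<Phi> x) (\<Phi> y)) \<longlongrightarrow> M * dist (\<Phi> x) (\<Phi> x)) (nhds x)"
      by (intro tendsto_intros)
    then have "\<forall>\<^sub>F y in nhds x. M * dist (\<Phi> x) (\<Phi> y) < e"
      using \<open>e > 0\<close> by (intro order_tendstoD) auto
    then show ?thesis
      by eventually_elim (use M conj in \<open>fastforce intro: le_less_trans\<close>)
  qed
  have step: "\<exists>d>0. \<forall>s1 s2. \<bar>s1 - s0\<bar> < d \<longrightarrow> \<bar>s2 - s0\<bar> < d \<longrightarrow> isCont (\<psi> s1) x \<longrightarrow> isCont (\<psi> s2) x"
    for s0
  proof -
    obtain B where B: "compact B" "\<psi> s0 x \<in> interior B" "inj_on \<Phi> B"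
      using loc by blast
    have "isCont (\<lambda>t. \<psi> t x) s0"
      using orbit by (simp add: continuous_on_eq_continuous_at)
    then have "\<forall>\<^sub>F s in nhds s0. \<psi> s x \<in> interior B"
      using topological_tendstoD[OF _ open_interior B(2)] unfolding isCont_iff_tendsto_nhds by blast
    then obtain d where d: "d > 0" "\<And>s. \<bar>s - s0\<bar> < d \<Longrightarrow> \<psi> s x \<in> interior B"
      by (auto simp: eventually_nhds_metric dist_real_def)
    define I where "I = {s0 - d/2 .. s0 + d/2}"
    have I: "compact I" "connected I" "\<And>s. s \<in> I \<Longrightarrow> \<psi> s x \<in> interior B"
      using d unfolding I_def by (auto intro!: d(2))
    have fr: "compact (frontier B)" "frontier B \<subseteq> B" "frontier B \<inter> interior B = {}"
      using B(1) compact_imp_closed[OF B(1)]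
      by (auto simp: frontier_def closed_Diff compact_diff)
    have disj: "\<Phi> ` frontier B \<inter> (\<lambda>s. \<Phi> (\<psi> s x)) ` I = {}"
    proof -
      have "\<Phi> b \<noteq> \<Phi> (\<psi> s x)" if "b \<in> frontier B" "s \<in> I" for b s
        using inj_onD[OF B(3), of b "\<psi> s x"] I(3)[OF that(2)] fr that interior_subset by blast
      then show ?thesis by blast
    qed
    have comp: "compact (\<Phi> ` frontier B)" "compact ((\<lambda>s. \<Phi> (\<psi> s x)) ` I)"
      using fr(1) I(1) \<Phi> continuous_on_compose2[OF \<Phi> orbit[of x]]
      by (auto intro!: compact_continuous_image intro: continuous_on_subset)
    obtain e where e: "e > 0" "\<And>b s. b \<in> frontier B \<Longrightarrow> s \<in> I \<Longrightarrow> e \<le> dist (\<Phi> b) (\<Phi> (\<psi> s x))"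
      using separate_compact_closed[OF comp(1) compact_imp_closed[OF comp(2)] disj] by blast
    \<comment> \<open>Continuity at the single time \<open>s1\<close> puts nearby orbits into \<open>B\<close>; they stay there during \<open>I\<close>.\<close>
    have "isCont (\<psi> s2) x" if s: "s1 \<in> I" "s2 \<in> I" "isCont (\<psi> s1) x" for s1 s2
    proof -
      have "(\<psi> s1 \<longlongrightarrow> \<psi> s1 x) (nhds x)"
        using s(3) by (simp only: isCont_iff_tendsto_nhds)
      then have "\<forall>\<^sub>F y in nhds x. \<psi> s1 y \<in> interior B"
        by (rule topological_tendstoD[OF _ open_interior I(3)[OF s(1)]])
      moreover have "\<forall>\<^sub>F y in nhds x. \<forall>s\<in>I. dist (\<Phi> (\<psi> s x)) (\<Phi> (\<psi> s y)) < e"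
        using I e by (intro \<Phi>_near)
      ultimately have inB: "\<forall>\<^sub>F y in nhds x. \<psi> s2 y \<in> B"
      proof eventually_elim
        case (elim y)
        have "connected ((\<lambda>s. \<psi> s y) ` I)"
          by (intro connected_continuous_image I continuous_on_subset[OF orbit]) auto
        moreover have "(\<lambda>s. \<psi> s y) ` I \<inter> frontier B = {}"
          using elim(2) e(2) by (force simp: dist_commute)
        moreover have "(\<lambda>s. \<psi> s y) ` I \<inter> B \<noteq> {}"
          using elim(1) s(1) interior_subset by blast
        ultimately have "(\<lambda>s. \<psi> s y) ` I - B = {}"
          using connected_Int_frontier by blast
        then show ?case using s(2) by blast
      qed
      have "(\<psi> s2 \<longlongrightarrow> \<psi> s2 x) (nhds x)"
      proof (rule topological_tendstoI)
        fix N assume N: "open N" "\<psi> s2 x \<in> N"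
        have "\<Phi> (\<psi> s2 x) \<notin> \<Phi> ` (B - N)"
          using inj_onD[OF B(3), of "\<psi> s2 x"] I(3)[OF s(2)] N(2) interior_subset by blast
        moreover have "closed (\<Phi> ` (B - N))"
          using B(1) N(1) \<Phi>
          by (auto intro!: compact_imp_closed compact_continuous_image compact_diff
              intro: continuous_on_subset)
        ultimately obtain e' where e': "e' > 0" "\<And>b. b \<in> B - N \<Longrightarrow> e' \<le> dist (\<Phi> (\<psi> s2 x)) (\<Phi> b)"
          using separate_point_closed[of "\<Phi> ` (B - N)" "\<Phi> (\<psi> s2 x)"] by blast
        show "\<forall>\<^sub>F y in nhds x. \<psi> s2 y \<in> N"
          using inB \<Phi>_near[OF compact_sing[of s2] e'(1)]
          by eventually_elim (use e'(2) in force)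
      qed
      then show ?thesis by (simp add: isCont_iff_tendsto_nhds)
    qed
    moreover have "s \<in> I" if "\<bar>s - s0\<bar> < d/2" for s
      using that unfolding I_def by (auto simp: abs_if split: if_splits)
    ultimately show ?thesis
      using d(1) by (intro exI[of _ "d/2"]) auto
  qed
  have loc_const: "\<forall>\<^sub>F b in at s0. isCont (\<psi> s0) x = isCont (\<psi> b) x" for s0
  proof -
    obtain d where d: "d > 0"
      "\<forall>s1 s2. \<bar>s1 - s0\<bar> < d \<longrightarrow> \<bar>s2 - s0\<bar> < d \<longrightarrow> isCont (\<psi> s1) x \<longrightarrow> isCont (\<psi> s2) x"
      using step[of s0] by blast
    show "\<forall>\<^sub>F b in at s0. isCont (\<psi> s0) x = isCont (\<psi> b) x"
      unfolding eventually_at dist_real_def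
    proof (rule exI[of _ d], rule conjI[OF d(1)], rule ballI, rule impI)
      fix b assume b: "b \<noteq> s0 \<and> \<bar>b - s0\<bar> < d"
      have "\<bar>s0 - s0\<bar> < d" using d(1) by simp
      then show "isCont (\<psi> s0) x = isCont (\<psi> b) x" using d(2) b by blast
    qed
  qed
  have "isCont (\<psi> 0) x = isCont (\<psi> t) x"
    by (rule connected_local_const[of UNIV]) (use loc_const in auto)
  moreover have "\<psi> 0 = (\<lambda>x. x)" using zero by auto
  ultimately show ?thesis by simp
qed

text \<open>
  Uniqueness of lifts: the times at which the two curves meet form a closed set because the
  space is Hausdorff, and an open one because \<open>\<Phi>\<close> is locally injective.
\<close>
lemma lifts_agree:
  fixes \<gamma>1 \<gamma>2 :: "real \<Rightarrow> 'x::t2_space" and \<Phi> :: "'x \<Rightarrow> 'v"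
  assumes loc: "\<And>p. \<exists>B. p \<in> interior B \<and> inj_on \<Phi> B"
    and cont: "continuous_on UNIV \<gamma>1" "continuous_on UNIV \<gamma>2"
    and eq: "\<And>s. \<Phi> (\<gamma>1 s) = \<Phi> (\<gamma>2 s)"
    and start: "\<gamma>1 s0 = \<gamma>2 s0"
  shows "\<gamma>1 s = \<gamma>2 s"
proof -
  have lim: "(\<gamma>1 \<longlongrightarrow> \<gamma>1 r) (at r)" "(\<gamma>2 \<longlongrightarrow> \<gamma>2 r) (at r)" for r
    using cont by (auto simp: continuous_on_def)
  have loc_const: "\<forall>\<^sub>F b in at r. (\<gamma>1 r = \<gamma>2 r) = (\<gamma>1 b = \<gamma>2 b)" for r
  proof (cases "\<gamma>1 r = \<gamma>2 r")
    case True
    obtain B where B: "\<gamma>1 r \<in> interior B" "inj_on \<Phi> B" using loc by blast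
    have B2: "\<gamma>2 r \<in> interior B" using B(1) True by simp
    have "\<forall>\<^sub>F b in at r. \<gamma>1 b \<in> interior B" "\<forall>\<^sub>F b in at r. \<gamma>2 b \<in> interior B"
      using topological_tendstoD[OF lim(1) open_interior B(1)]
        topological_tendstoD[OF lim(2) open_interior B2] by blast+
    then show ?thesis
    proof eventually_elim
      case (elim b)
      then have "\<gamma>1 b \<in> B" "\<gamma>2 b \<in> B" using interior_subset[of B] by auto
      then have "\<gamma>1 b = \<gamma>2 b" by (rule inj_onD[OF B(2) eq[of b]])
      then show ?case using True by simp
    qed
  next
    case False
    obtain U V where UV: "open U" "open V" "\<gamma>1 r \<in> U" "\<gamma>2 r \<in> V" "U \<inter> V = {}"
      using hausdorff[OF False] by auto
    have "\<forall>\<^sub>F b in at r. \<gamma>1 b \<in> U" "\<forall>\<^sub>F b in at r. \<gamma>2 b \<in> V"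
      using topological_tendstoD[OF lim(1) UV(1,3)] topological_tendstoD[OF lim(2) UV(2,4)] .
    then show ?thesis
    proof eventually_elim
      case (elim b)
      then have "\<gamma>1 b \<noteq> \<gamma>2 b" using UV(5) by auto
      then show ?case using False by simp
    qed
  qed
  have "(\<gamma>1 s0 = \<gamma>2 s0) = (\<gamma>1 s = \<gamma>2 s)"
    by (rule connected_local_const[of UNIV]) (use loc_const in auto)
  then show ?thesis using start by simp
qed

section \<open>Immersions and jointly injective linear maps\<close>

text \<open>
  The inverse function theorem needs derivatives that are close in operator norm; in finite
  dimension it suffices that the directional derivatives are continuous, since the operator norm
  is at most the sum of the norms of the values on a basis.
\<close>
lemma C1_immersion_locally_injective:
  fixes F :: "'a::euclidean_space \<Rightarrow> 'b::euclidean_space"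
  assumes "open S" "q \<in> S"
    and deriv: "\<And>x. x \<in> S \<Longrightarrow> (F has_derivative F' x) (at x)"
    and cont: "\<And>v. continuous_on S (\<lambda>x. F' x v)"
    and inj: "inj (F' q)"
  obtains r where "r > 0" "ball q r \<subseteq> S" "inj_on F (ball q r)"
proof -
  have lin: "linear (F' x)" if "x \<in> S" for x
    using deriv[OF that] by (rule has_derivative_linear)
  obtain L where L: "linear L" "L \<circ> F' q = id"
    using linear_injective_left_inverse[OF lin[OF \<open>q \<in> S\<close>] inj] by blast
  have small: "\<exists>d>0. \<forall>x. dist q x < d \<longrightarrow> onorm (\<lambda>v. F' x v - F' q v) < e" if "e > 0" for e
  proof -
    have "((\<lambda>x. \<Sum>i\<in>Basis. norm (F' x i - F' q i)) \<longlongrightarrow> (\<Sum>i\<in>Basis. norm (F' q i - F' q i))) (nhds q)"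
    proof (intro tendsto_sum tendsto_norm tendsto_diff tendsto_const)
      fix i
      show "((\<lambda>x. F' x i) \<longlongrightarrow> F' q i) (nhds q)"
        using cont[of i] \<open>open S\<close> \<open>q \<in> S\<close>
        by (simp add: continuous_on_eq_continuous_at isCont_iff_tendsto_nhds)
    qed
    then have "\<forall>\<^sub>F x in nhds q. (\<Sum>i\<in>Basis. norm (F' x i - F' q i)) < e"
      using that by (intro order_tendstoD) auto
    moreover have "\<forall>\<^sub>F x in nhds q. x \<in> S"
      using \<open>open S\<close> \<open>q \<in> S\<close> by (rule eventually_nhds_in_open)
    ultimately have "\<forall>\<^sub>F x in nhds q. onorm (\<lambda>v. F' x v - F' q v) < e"
    proof eventually_elim
      case (elim x)
      have "bounded_linear (\<lambda>v. F' x v - F' q v)"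
        using deriv[OF elim(2)] deriv[OF \<open>q \<in> S\<close>]
        by (intro bounded_linear_sub has_derivative_bounded_linear)
      from onorm_componentwise[OF this] elim(1) show ?case by linarith
    qed
    then show ?thesis by (auto simp: eventually_nhds_metric dist_commute)
  qed
  show ?thesis
    using has_derivative_locally_injective[OF \<open>q \<in> S\<close> \<open>open S\<close> _ L(2) deriv small] that L(1)
    by (metis linear_conv_bounded_linear)
qed

text \<open>
  With a linear left inverse \<open>L\<close> of \<open>F'\<close>, \<open>L\<close> applied to \<open>F (G y) - F (G p)\<close> is
  \<open>G y - G p\<close> up to a small multiple of \<open>norm (G y - G p)\<close>.  Absorbing that error first shows that
  \<open>G\<close> is Lipschitz at \<open>p\<close>, and then that it has the derivative \<open>L \<circ> H'\<close>.
\<close>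
lemma has_derivative_cancel_immersion:
  fixes F :: "'b::euclidean_space \<Rightarrow> 'c::euclidean_space"
    and G :: "'a::euclidean_space \<Rightarrow> 'b"
  assumes F: "(F has_derivative F') (at (G p))" and "inj F'"
    and G: "isCont G p"
    and H: "((\<lambda>y. F (G y)) has_derivative H') (at p)"
  shows "G differentiable (at p)"
proof -
  have "linear F'" using F by (rule has_derivative_linear)
  then obtain L where L: "linear L" "L \<circ> F' = id"
    using linear_injective_left_inverse[OF _ \<open>inj F'\<close>] by blast
  interpret L: bounded_linear L using L(1) by (simp add: linear_conv_bounded_linear)
  interpret F': linear F' by fact
  have LF: "L (F' v) = v" for v using L(2) by (metis comp_apply id_apply)
  interpret H': bounded_linear H' using H by (rule has_derivative_bounded_linear)
  obtain KL where KL: "KL > 0" "\<And>v. norm (L v) \<le> norm v * KL" using L.pos_bounded by blast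
  obtain KH where KH: "KH > 0" "\<And>v. norm (H' v) \<le> norm v * KH" using H'.pos_bounded by blast
  have Fe: "\<forall>\<^sub>F y in nhds p. norm (F (G y) - F (G p) - F' (G y - G p)) \<le> e * norm (G y - G p)"
    if "e > 0" for e
  proof -
    obtain d where d: "d > 0" "\<And>u. norm (u - G p) < d \<Longrightarrow> norm (F u - F (G p) - F' (u - G p)) \<le> e * norm (u - G p)"
      using F \<open>e > 0\<close> unfolding has_derivative_at_alt by blast
    have "(G \<longlongrightarrow> G p) (nhds p)"
      using G by (simp add: isCont_iff_tendsto_nhds)
    then have "\<forall>\<^sub>F y in nhds p. dist (G y) (G p) < d" using d(1) by (rule tendstoD)
    then show ?thesis by eventually_elim (use d(2) in \<open>auto simp: dist_norm\<close>)
  qed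
  have He: "\<forall>\<^sub>F y in nhds p. norm (F (G y) - F (G p) - H' (y - p)) \<le> e * norm (y - p)"
    if "e > 0" for e
  proof -
    obtain d where d: "d > 0" "\<And>y. norm (y - p) < d \<Longrightarrow> norm (F (G y) - F (G p) - H' (y - p)) \<le> e * norm (y - p)"
      using H \<open>e > 0\<close> unfolding has_derivative_at_alt by blast
    then show ?thesis by (auto simp: eventually_nhds_metric dist_norm)
  qed
  define C where "C = 2 * KL * (1 + KH)"
  have C: "C > 0" using KL KH by (simp add: C_def)
  have KL': "1 / (2 * KL) > 0" using KL(1) by simp
  \<comment> \<open>The error bound \<open>1 / (2 * KL)\<close> leaves, after applying \<open>L\<close>, half of \<open>norm (G y - G p)\<close> to absorb.\<close>
  have lip: "\<forall>\<^sub>F y in nhds p. norm (G y - G p) \<le> C * norm (y - p)"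
    using Fe[OF KL'] He[OF zero_less_one]
  proof eventually_elim
    case (elim y)
    have "G y - G p = L (F (G y) - F (G p)) - L (F (G y) - F (G p) - F' (G y - G p))"
      by (simp add: L.diff LF)
    then have "norm (G y - G p) \<le> norm (L (F (G y) - F (G p))) + norm (L (F (G y) - F (G p) - F' (G y - G p)))"
      by (metis norm_triangle_ineq4)
    also have "\<dots> \<le> norm (F (G y) - F (G p)) * KL + norm (F (G y) - F (G p) - F' (G y - G p)) * KL"
      by (intro add_mono KL)
    also have "norm (F (G y) - F (G p) - F' (G y - G p)) * KL \<le> norm (G y - G p) / (2 * KL) * KL"
      using elim(1) KL(1) by (intro mult_right_mono) auto
    also have "\<dots> = norm (G y - G p) / 2" using KL(1) by simp
    also have "norm (F (G y) - F (G p)) \<le> norm (F (G y) - F (G p) - H' (y - p)) + norm (H' (y - p))"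
      by norm
    also have "\<dots> \<le> norm (y - p) + norm (y - p) * KH"
      using elim(2) KH by (intro add_mono) auto
    finally show ?case using KL(1) by (simp add: C_def algebra_simps)
  qed
  have "(G has_derivative (\<lambda>v. L (H' v))) (at p)"
    unfolding has_derivative_at_alt
  proof (intro conjI allI impI)
    show "bounded_linear (\<lambda>v. L (H' v))"
      using L.bounded_linear_axioms H'.bounded_linear_axioms by (rule bounded_linear_compose)
    fix e :: real assume "e > 0"
    define e1 where "e1 = e / (2 * KL * C)"
    define e2 where "e2 = e / (2 * KL)"
    have e: "e1 > 0" "e2 > 0" "KL * (e1 * C) = e/2" "KL * e2 = e/2"
      using \<open>e > 0\<close> KL C by (auto simp: e1_def e2_def)
    have "\<forall>\<^sub>F y in nhds p. norm (G y - G p - L (H' (y - p))) \<le> e * norm (y - p)"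
      using Fe[OF e(1)] He[OF e(2)] lip
    proof eventually_elim
      case (elim y)
      have "G y - G p - L (H' (y - p)) =
          L (F (G y) - F (G p) - H' (y - p)) - L (F (G y) - F (G p) - F' (G y - G p))"
        by (simp add: L.diff LF)
      then have "norm (G y - G p - L (H' (y - p)))
          \<le> norm (L (F (G y) - F (G p) - H' (y - p))) + norm (L (F (G y) - F (G p) - F' (G y - G p)))"
        by (metis norm_triangle_ineq4)
      also have "\<dots> \<le> norm (F (G y) - F (G p) - H' (y - p)) * KL + norm (F (G y) - F (G p) - F' (G y - G p)) * KL"
        by (intro add_mono KL)
      also have "\<dots> \<le> (e2 * norm (y - p)) * KL + (e1 * (C * norm (y - p))) * KL"
      proof (intro add_mono mult_right_mono)
        show "norm (F (G y) - F (G p) - F' (G y - G p)) \<le> e1 * (C * norm (y - p))"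
          by (rule order_trans[OF elim(1)]) (use elim(3) e(1) in simp)
      qed (use elim KL in auto)
      also have "\<dots> = (KL * e2 + KL * (e1 * C)) * norm (y - p)"
        by (simp add: algebra_simps)
      finally show ?case using e by simp
    qed
    then show "\<exists>d>0. \<forall>y. norm (y - p) < d \<longrightarrow> norm (G y - G p - L (H' (y - p))) \<le> e * norm (y - p)"
      by (auto simp: eventually_nhds_metric dist_norm)
  qed
  then show ?thesis by (auto simp: differentiable_def)
qed

lemma has_derivative_vec_lambda:
  fixes h :: "'n::finite \<Rightarrow> 'a::real_normed_vector \<Rightarrow> 'b::euclidean_space"
  assumes "\<And>i. (h i has_derivative h' i) (at x)"
  shows "((\<lambda>y. \<chi> i. h i y) has_derivative (\<lambda>v. \<chi> i. h' i v)) (at x)"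
proof -
  have lin: "bounded_linear (axis i :: 'b \<Rightarrow> 'b^'n)" for i
    unfolding linear_conv_bounded_linear[symmetric]
    by (rule linearI; simp add: vec_eq_iff axis_def)
  have sum_axis: "(\<chi> i. z i) = (\<Sum>i\<in>UNIV. axis i (z i))" for z :: "'n \<Rightarrow> 'b"
    by (simp add: vec_eq_iff axis_def)
  have "((\<lambda>y. \<Sum>i\<in>UNIV. axis i (h i y)) has_derivative (\<lambda>v. \<Sum>i\<in>UNIV. axis i (h' i v))) (at x)"
    by (intro has_derivative_sum bounded_linear.has_derivative[OF lin] assms)
  then show ?thesis by (simp only: sum_axis)
qed

text \<open>
  The right-hand side is positive on the compact unit sphere and homogeneous of degree one.
\<close>
lemma jointly_injective_norm_bound:
  fixes \<alpha> :: "'a::euclidean_space \<Rightarrow> real" and \<beta> :: "'i \<Rightarrow> 'a \<Rightarrow> 'b::real_normed_vector"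
  assumes "linear \<alpha>" "\<And>j. j \<in> J \<Longrightarrow> linear (\<beta> j)"
    and inj: "\<And>u. \<alpha> u = 0 \<Longrightarrow> (\<And>j. j \<in> J \<Longrightarrow> \<beta> j u = 0) \<Longrightarrow> u = 0"
    and "finite J"
  obtains C where "C > 0" "\<And>u. norm u \<le> C * (\<bar>\<alpha> u\<bar> + (\<Sum>j\<in>J. norm (\<beta> j u)))"
proof -
  define q where "q u = \<bar>\<alpha> u\<bar> + (\<Sum>j\<in>J. norm (\<beta> j u))" for u
  have q_nonneg: "q u \<ge> 0" for u
    unfolding q_def by (intro add_nonneg_nonneg sum_nonneg) auto
  have q_pos: "q u > 0" if "u \<noteq> 0" for u
  proof -
    have "q u \<noteq> 0"
    proof
      assume "q u = 0"
      then have "\<bar>\<alpha> u\<bar> = 0 \<and> (\<Sum>j\<in>J. norm (\<beta> j u)) = 0"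
        unfolding q_def by (subst (asm) add_nonneg_eq_0_iff) (auto intro: sum_nonneg)
      then have "\<alpha> u = 0" "\<And>j. j \<in> J \<Longrightarrow> \<beta> j u = 0"
        using \<open>finite J\<close> by (auto simp: sum_nonneg_eq_0_iff)
      then show False using inj that by blast
    qed
    then show ?thesis using q_nonneg[of u] by linarith
  qed
  have q_scale: "q (r *\<^sub>R u) = \<bar>r\<bar> * q u" for r u
    using assms(1,2) by (simp add: q_def linear_scale abs_mult sum_distrib_left distrib_left)
  have "continuous_on UNIV q"
    unfolding q_def using assms(1,2)
    by (intro continuous_intros linear_continuous_on) (auto simp: linear_conv_bounded_linear)
  then have cont: "continuous_on (sphere 0 1) q" by (rule continuous_on_subset) auto
  obtain e where e: "e > 0" "\<And>u. norm u = 1 \<Longrightarrow> e \<le> q u"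
  proof (cases "sphere (0::'a) 1 = {}")
    case True
    then show ?thesis using that[of 1] by auto
  next
    case False
    then obtain s where "s \<in> sphere 0 1" "\<And>u. u \<in> sphere 0 1 \<Longrightarrow> q s \<le> q u"
      using continuous_attains_inf[OF compact_sphere False cont] by blast
    then show ?thesis using that[of "q s"] q_pos[of s] by force
  qed
  have "norm u \<le> (1 / e) * q u" for u
  proof (cases "u = 0")
    case False
    have "e \<le> q ((1 / norm u) *\<^sub>R u)" using False by (intro e) simp
    then show ?thesis using False e(1) by (simp add: q_scale field_simps)
  qed (use e q_nonneg in simp)
  then show ?thesis using that[of "1 / e"] e(1) unfolding q_def by simp
qed

section \<open>Tangent vectors and differentials in charts\<close>

lemma has_derivative_transform_eventually_nhds:
  assumes f: "(f has_derivative f') (at x)" and eq: "\<forall>\<^sub>F y in nhds x. f y = g y"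
  shows "(g has_derivative f') (at x)"
proof (rule has_derivative_transform_eventually[OF f])
  show "\<forall>\<^sub>F y in at x. f y = g y"
    using eq eventually_nhds_conv_at by blast
  show "f x = g x" using eq by (rule eventually_nhds_x_imp_x)
qed simp

context
  fixes A :: "('m::{t2_space, second_countable_topology}, 'n::finite) chart set"
  assumes atlas: "smooth_atlas A"
begin

lemma charts_atD:
  assumes "c \<in> charts_at A x"
  shows "c \<in> A" "x \<in> cdom c" "open (cdom c)" "open (cmap c ` cdom c)"
    "homeomorphism (cdom c) (cmap c ` cdom c) (cmap c) (cinv c)"
  using assms atlas by (auto simp: charts_at_def smooth_atlas_def)

lemma cinv_cmap: "c \<in> charts_at A x \<Longrightarrow> cinv c (cmap c x) = x"
  using charts_atD homeomorphism_apply1 by metis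

lemma chart_at_in: "chart_at A x \<in> charts_at A x"
proof -
  have "\<exists>c. c \<in> charts_at A x"
    using atlas unfolding smooth_atlas_def charts_at_def by blast
  then show ?thesis unfolding chart_at_def by (rule someI_ex)
qed

lemma isCont_cmap:
  assumes "c \<in> charts_at A x"
  shows "isCont (cmap c) x"
  using charts_atD[OF assms] homeomorphism_cont1 continuous_on_eq_continuous_at by metis

lemma isCont_cinv:
  assumes "c \<in> charts_at A x"
  shows "isCont (cinv c) (cmap c x)"
  using charts_atD[OF assms] homeomorphism_cont2 continuous_on_eq_continuous_at imageI by metis

text \<open>
  The chain rule with intermediate point on the manifold.  Taking an inverse chart for \<open>G\<close> gives
  the change of chart, taking a self-map of the manifold after an inverse chart gives the
  functoriality of tangent maps.
\<close>
lemma has_derivative_through_chart: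
  fixes G :: "'a::euclidean_space \<Rightarrow> 'm" and h :: "'m \<Rightarrow> 'b::real_normed_vector"
  assumes G: "isCont G p" "((cmap d \<circ> G) has_derivative G') (at p)"
    and d: "d \<in> charts_at A (G p)"
    and h: "((h \<circ> cinv d) has_derivative h') (at (cmap d (G p)))"
  shows "((h \<circ> G) has_derivative (h' \<circ> G')) (at p)"
proof -
  have "((\<lambda>y. (h \<circ> cinv d) ((cmap d \<circ> G) y)) has_derivative (\<lambda>v. h' (G' v))) (at p)"
    by (rule has_derivative_compose[OF G(2)]) (use h in \<open>simp add: comp_def\<close>)
  moreover have "\<forall>\<^sub>F y in nhds p. (h \<circ> cinv d) ((cmap d \<circ> G) y) = (h \<circ> G) y"
  proof -
    have "\<forall>\<^sub>F y in nhds p. G y \<in> cdom d"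
      using G(1) charts_atD(2,3)[OF d] topological_tendstoD isCont_iff_tendsto_nhds by blast
    then show ?thesis
      by eventually_elim (use homeomorphism_apply1[OF charts_atD(5)[OF d]] in simp)
  qed
  ultimately have "((h \<circ> G) has_derivative (\<lambda>v. h' (G' v))) (at p)"
    by (rule has_derivative_transform_eventually_nhds)
  then show ?thesis by (simp add: o_def)
qed

lemma transition_has_derivative:
  assumes "c \<in> charts_at A x" "d \<in> charts_at A x"
  shows "((cmap d \<circ> cinv c) has_derivative transition_deriv c d x) (at (cmap c x))"
proof -
  have "smooth_on (cmap d \<circ> cinv c) (cmap c ` (cdom c \<inter> cdom d))"
    using assms atlas by (auto simp: smooth_atlas_def charts_at_def)
  then have "Ck_on (Suc 0) (cmap d \<circ> cinv c) (cmap c ` (cdom c \<inter> cdom d))"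
    unfolding smooth_on_def by blast
  then have "(cmap d \<circ> cinv c) differentiable (at (cmap c x))"
    using charts_atD(2) assms by simp
  then show ?thesis
    unfolding transition_deriv_def by (simp add: frechet_derivative_works)
qed

lemma has_derivative_change_chart:
  fixes h :: "'m \<Rightarrow> 'b::real_normed_vector"
  assumes c: "c \<in> charts_at A x" and d: "d \<in> charts_at A x"
    and h: "((h \<circ> cinv d) has_derivative h') (at (cmap d x))"
  shows "((h \<circ> cinv c) has_derivative (h' \<circ> transition_deriv c d x)) (at (cmap c x))"
  using has_derivative_through_chart[OF isCont_cinv[OF c] transition_has_derivative[OF c d]] d h
  by (simp add: cinv_cmap[OF c])

lemma transition_deriv_comp:
  assumes c: "c \<in> charts_at A x" and d: "d \<in> charts_at A x" and e: "e \<in> charts_at A x"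
  shows "transition_deriv d e x (transition_deriv c d x u) = transition_deriv c e x u"
proof -
  have "transition_deriv c e x = transition_deriv d e x \<circ> transition_deriv c d x"
    by (rule has_derivative_unique[OF transition_has_derivative[OF c e]
        has_derivative_change_chart[OF c d transition_has_derivative[OF d e]]])
  then show ?thesis by simp
qed

lemma transition_deriv_refl:
  assumes c: "c \<in> charts_at A x"
  shows "transition_deriv c c x u = u"
proof -
  have "\<forall>\<^sub>F p in nhds (cmap c x). p \<in> cmap c ` cdom c"
    using charts_atD[OF c] by (intro eventually_nhds_in_open) auto
  then have "\<forall>\<^sub>F p in nhds (cmap c x). p = (cmap c \<circ> cinv c) p"
    by eventually_elim (use homeomorphism_apply2[OF charts_atD(5)[OF c]] in simp)
  from has_derivative_transform_eventually_nhds[OF has_derivative_ident this]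
  have "transition_deriv c c x = (\<lambda>u. u)"
    using transition_has_derivative[OF c c] has_derivative_unique by blast
  then show ?thesis by simp
qed

lemma linear_transition_deriv:
  assumes "c \<in> charts_at A x" "d \<in> charts_at A x"
  shows "linear (transition_deriv c d x)"
  using transition_has_derivative[OF assms] by (rule has_derivative_linear)

lemma tangent_space_coords:
  "v \<in> tangent_space A x \<Longrightarrow> c \<in> charts_at A x \<Longrightarrow> d \<in> charts_at A x \<Longrightarrow>
    v d = transition_deriv c d x (v c)"
  unfolding tangent_space_def by blast

lemma tangent_space_off_chart:
  "v \<in> tangent_space A x \<Longrightarrow> c \<notin> charts_at A x \<Longrightarrow> v c = 0"
  unfolding tangent_space_def by blast

lemma tv_of_coords_in:
  assumes c: "c \<in> charts_at A x"
  shows "tv_of_coords A c x u \<in> tangent_space A x"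
  unfolding tangent_space_def tv_of_coords_def
  by (simp add: transition_deriv_comp[OF c])

lemma tv_of_coords_apply: "c \<in> charts_at A x \<Longrightarrow> tv_of_coords A c x u c = u"
  by (simp add: tv_of_coords_def transition_deriv_refl)

lemma tv_of_coords_of:
  assumes c: "c \<in> charts_at A x" and v: "v \<in> tangent_space A x"
  shows "tv_of_coords A c x (v c) = v"
proof
  fix d show "tv_of_coords A c x (v c) d = v d"
    using tangent_space_coords[OF v c] tangent_space_off_chart[OF v]
    unfolding tv_of_coords_def by presburger
qed

lemma tv_zero_in: "tv_zero \<in> tangent_space A x"
  by (simp add: tangent_space_def tv_zero_def linear_0[OF linear_transition_deriv])

lemma tv_add_in:
  assumes "u \<in> tangent_space A x" "v \<in> tangent_space A x"
  shows "tv_add u v \<in> tangent_space A x"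
  unfolding tangent_space_def
proof (intro CollectI conjI allI impI ballI)
  fix c d assume c: "c \<in> charts_at A x" and d: "d \<in> charts_at A x"
  show "tv_add u v d = transition_deriv c d x (tv_add u v c)"
    unfolding tv_add_def linear_add[OF linear_transition_deriv[OF c d]]
    using tangent_space_coords[OF _ c d] assms by metis
qed (simp add: tv_add_def tangent_space_off_chart[OF assms(1)] tangent_space_off_chart[OF assms(2)])

lemma tv_scale_in:
  assumes "v \<in> tangent_space A x"
  shows "tv_scale a v \<in> tangent_space A x"
  unfolding tangent_space_def
proof (intro CollectI conjI allI impI ballI)
  fix c d assume c: "c \<in> charts_at A x" and d: "d \<in> charts_at A x"
  show "tv_scale a v d = transition_deriv c d x (tv_scale a v c)"
    unfolding tv_scale_def linear_scale[OF linear_transition_deriv[OF c d]]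
    using tangent_space_coords[OF _ c d] assms by metis
qed (simp add: tv_scale_def tangent_space_off_chart[OF assms])

lemma tv_of_coords_linear:
  assumes c: "c \<in> charts_at A x"
  shows "tv_of_coords A c x (u + v) = tv_add (tv_of_coords A c x u) (tv_of_coords A c x v)"
    "tv_of_coords A c x (a *\<^sub>R u) = tv_scale a (tv_of_coords A c x u)"
  by (simp_all add: tv_of_coords_def tv_add_def tv_scale_def fun_eq_iff
      linear_add[OF linear_transition_deriv[OF c]] linear_scale[OF linear_transition_deriv[OF c]])

text \<open>
  The chart chosen in the definition of the differential does not matter, because the
  coordinates of a tangent vector transform by the derivative of the transition map.
\<close>
lemma differential_eq:
  fixes h :: "'m \<Rightarrow> 'b::real_normed_vector"
  assumes c: "c \<in> charts_at A x" and h: "((h \<circ> cinv c) has_derivative h') (at (cmap c x))"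
    and v: "v \<in> tangent_space A x"
  shows "differential A h x v = h' (v c)"
proof -
  let ?d = "chart_at A x"
  have "((h \<circ> cinv ?d) has_derivative (h' \<circ> transition_deriv ?d c x)) (at (cmap ?d x))"
    by (rule has_derivative_change_chart[OF chart_at_in c h])
  then have "frechet_derivative (h \<circ> cinv ?d) (at (cmap ?d x)) = h' \<circ> transition_deriv ?d c x"
    by (metis frechet_derivative_at)
  then show ?thesis
    using tangent_space_coords[OF v chart_at_in c] by (simp add: differential_def Let_def)
qed

lemma Ck_observable_has_derivative:
  fixes h :: "'m \<Rightarrow> 'b::real_normed_vector"
  assumes h: "Ck_observable A 1 U h" and "x \<in> U" and c: "c \<in> charts_at A x"
  shows "((h \<circ> cinv c) has_derivative (\<lambda>u. differential A h x (tv_of_coords A c x u))) (at (cmap c x))"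
proof -
  have "Ck_on (Suc 0) (h \<circ> cinv c) (cmap c ` (cdom c \<inter> U))"
    using h charts_atD(1)[OF c] by (simp add: Ck_observable_def)
  then have "(h \<circ> cinv c) differentiable (at (cmap c x))"
    using charts_atD(2)[OF c] \<open>x \<in> U\<close> by simp
  then obtain h' where h': "((h \<circ> cinv c) has_derivative h') (at (cmap c x))"
    by (auto simp: differentiable_def)
  moreover have "h' = (\<lambda>u. differential A h x (tv_of_coords A c x u))"
    using differential_eq[OF c h' tv_of_coords_in[OF c]] by (simp add: tv_of_coords_apply[OF c])
  ultimately show ?thesis by simp
qed

lemma Ck_observable_isCont:
  fixes h :: "'m \<Rightarrow> 'b::real_normed_vector"
  assumes h: "Ck_observable A 1 U h" and "x \<in> U"
  shows "isCont h x"
proof -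
  let ?c = "chart_at A x"
  note c = chart_at_in[of x]
  have "isCont (h \<circ> cinv ?c) (cmap ?c x)"
    using Ck_observable_has_derivative[OF assms c] has_derivative_continuous by blast
  then have "isCont (\<lambda>y. (h \<circ> cinv ?c) (cmap ?c y)) x"
    using isCont_comp[OF isCont_cmap[OF c]] unfolding comp_def by blast
  moreover have "\<forall>\<^sub>F y in nhds x. (h \<circ> cinv ?c) (cmap ?c y) = h y"
  proof -
    have "\<forall>\<^sub>F y in nhds x. y \<in> cdom ?c"
      using charts_atD[OF c] by (intro eventually_nhds_in_open)
    then show ?thesis
      by eventually_elim (use homeomorphism_apply1[OF charts_atD(5)[OF c]] in simp)
  qed
  ultimately show ?thesis by (simp add: isCont_cong)
qed

lemma differential_linear:
  fixes h :: "'m \<Rightarrow> 'b::real_normed_vector"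
  assumes "Ck_observable A 1 UNIV h" "c \<in> charts_at A x"
  shows "linear (\<lambda>u. differential A h x (tv_of_coords A c x u))"
  using Ck_observable_has_derivative[OF assms(1) UNIV_I assms(2)] by (rule has_derivative_linear)

lemma
  fixes F :: "'m \<Rightarrow> 'm"
  assumes F: "isCont F x"
    and diff: "\<And>d. d \<in> charts_at A (F x) \<Longrightarrow>
      (cmap d \<circ> F \<circ> cinv (chart_at A x)) differentiable (at (cmap (chart_at A x) x))"
    and v: "v \<in> tangent_space A x"
  shows tangent_map_in: "tangent_map A F x v \<in> tangent_space A (F x)"
    and differential_tangent_map: "Ck_observable A 1 UNIV h \<Longrightarrow>
      differential A h (F x) (tangent_map A F x v) = differential A (h \<circ> F) x v"
proof -
  let ?c = "chart_at A x"
  note c = chart_at_in[of x]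
  define G where "G = F \<circ> cinv ?c"
  define G' where "G' d = frechet_derivative (cmap d \<circ> G) (at (cmap ?c x))" for d :: "('m, 'n) chart"
  have Gp: "G (cmap ?c x) = F x" by (simp add: G_def cinv_cmap[OF c])
  have G: "isCont G (cmap ?c x)"
    unfolding G_def using isCont_cinv[OF c] F by (intro isCont_comp) (simp_all add: cinv_cmap[OF c])
  have G': "((cmap d \<circ> G) has_derivative G' d) (at (cmap ?c x))" if "d \<in> charts_at A (F x)" for d
    using diff[OF that] by (simp add: G'_def G_def frechet_derivative_works comp_assoc)
  have tm: "tangent_map A F x v = (\<lambda>d. if d \<in> charts_at A (F x) then G' d (v ?c) else 0)"
    unfolding tangent_map_def G'_def G_def Let_def comp_assoc ..
  have chain: "((h \<circ> G) has_derivative (h' \<circ> G' d)) (at (cmap ?c x))"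
    if "d \<in> charts_at A (F x)" "((h \<circ> cinv d) has_derivative h') (at (cmap d (F x)))"
    for d h' and h :: "'m \<Rightarrow> 'b::real_normed_vector"
    using has_derivative_through_chart[OF G G'] that by (simp add: Gp)
  have G'_change: "G' e u = transition_deriv d e (F x) (G' d u)"
    if d: "d \<in> charts_at A (F x)" and e: "e \<in> charts_at A (F x)" for d e u
    using has_derivative_unique[OF G'[OF e] chain[OF d transition_has_derivative[OF d e]]] by simp
  show T: "tangent_map A F x v \<in> tangent_space A (F x)"
    unfolding tangent_space_def tm
  proof (intro CollectI conjI allI impI ballI)
    fix d e assume d: "d \<in> charts_at A (F x)" and e: "e \<in> charts_at A (F x)"
    show "(if e \<in> charts_at A (F x) then G' e (v ?c) else 0) =
        transition_deriv d e (F x) (if d \<in> charts_at A (F x) then G' d (v ?c) else 0)"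
      using G'_change[OF d e] by (simp only: d e if_True)
  qed (simp only: if_False)
  assume h: "Ck_observable A 1 UNIV h"
  let ?d = "chart_at A (F x)"
  note d = chart_at_in[of "F x"]
  note h' = Ck_observable_has_derivative[OF h UNIV_I d]
  have "differential A h (F x) (tangent_map A F x v)
      = differential A h (F x) (tv_of_coords A ?d (F x) (G' ?d (v ?c)))"
    using differential_eq[OF d h' T] d by (simp add: tm)
  moreover have D: "((h \<circ> F \<circ> cinv ?c) has_derivative
      (\<lambda>u. differential A h (F x) (tv_of_coords A ?d (F x) u)) \<circ> G' ?d) (at (cmap ?c x))"
    using chain[OF d h'] by (simp add: G_def comp_assoc)
  ultimately show "differential A h (F x) (tangent_map A F x v) = differential A (h \<circ> F) x v"
    using differential_eq[OF c D v] by simp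
qed

lemma continuous_tv_of_coords: "continuous_on UNIV (tv_of_coords A c x)" if "c \<in> charts_at A x"
proof (rule continuous_on_coordinatewise_then_product)
  fix d
  show "continuous_on UNIV (\<lambda>u. tv_of_coords A c x u d)"
    using linear_transition_deriv[OF that]
    by (cases "d \<in> charts_at A x") (simp_all add: tv_of_coords_def linear_continuous_on linear_conv_bounded_linear)
qed

text \<open>
  The topology of a tangent space, inherited from the product topology, is that of \<open>real ^ 'n\<close> under
  any chart: this and the next lemma reduce openness and closedness to coordinates.
\<close>
lemma openin_tangent_space:
  assumes c: "c \<in> charts_at A x" and "open {u. P (tv_of_coords A c x u)}"
  shows "openin (top_of_set (tangent_space A x)) {v \<in> tangent_space A x. P v}"
proof -
  let ?U = "{u. P (tv_of_coords A c x u)}"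
  have "open ((\<lambda>v :: ('m,'n) tvec. v c) -` ?U)"
    using assms(2) by (intro open_vimage continuous_on_product_coordinates)
  moreover have "{v \<in> tangent_space A x. P v} = tangent_space A x \<inter> (\<lambda>v. v c) -` ?U"
    using tv_of_coords_of[OF c] by force
  ultimately show ?thesis by (auto simp only: openin_open)
qed

lemma closedin_tangent_space:
  assumes c: "c \<in> charts_at A x" and "closed {u. P (tv_of_coords A c x u)}"
  shows "closedin (top_of_set (tangent_space A x)) {v \<in> tangent_space A x. P v}"
proof -
  let ?U = "{u. P (tv_of_coords A c x u)}"
  have "closed ((\<lambda>v :: ('m,'n) tvec. v c) -` ?U)"
    using assms(2) by (intro closed_vimage continuous_on_product_coordinates)
  moreover have "{v \<in> tangent_space A x. P v} = tangent_space A x \<inter> (\<lambda>v. v c) -` ?U"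
    using tv_of_coords_of[OF c] by force
  ultimately show ?thesis by (auto simp only: closedin_closed)
qed

text \<open>In coordinates, a set with interior contains a nonempty open set, and \<open>{0}\<close> is not open.\<close>
lemma nonzero_in_solid_set:
  assumes "tv_interior A x S \<noteq> {}"
  shows "\<exists>v\<in>S. v \<noteq> tv_zero"
proof -
  define c where "c = chart_at A x"
  have c: "c \<in> charts_at A x" unfolding c_def by (rule chart_at_in)
  obtain p U where U: "openin (top_of_set (tangent_space A x)) U" "U \<subseteq> S" "p \<in> U"
    using assms unfolding tv_interior_def interior_of_def by blast
  then obtain V where V: "open V" "U = tangent_space A x \<inter> V" by (auto simp only: openin_open)
  let ?W = "tv_of_coords A c x -` V"
  have "open ?W" using V(1) continuous_tv_of_coords[OF c] by (rule open_vimage)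
  moreover have "p c \<in> ?W" using U(3) V(2) tv_of_coords_of[OF c] by simp
  ultimately have "?W \<noteq> {0}" "?W \<noteq> {}" using not_open_singleton by (metis, blast)
  then obtain u where u: "u \<in> ?W" "u \<noteq> 0" by blast
  then have "tv_of_coords A c x u \<in> S"
    using U(2) V(2) tv_of_coords_in[OF c] by blast
  moreover have "tv_of_coords A c x u \<noteq> tv_zero"
    using u(2) tv_of_coords_apply[OF c] unfolding tv_zero_def by metis
  ultimately show ?thesis by blast
qed

context
  fixes g :: "'m \<Rightarrow> ('m, 'n) tvec \<Rightarrow> ('m, 'n) tvec \<Rightarrow> real"
  assumes metric: "riemannian_metric A g"
begin

lemma metric_props:
  assumes "u \<in> tangent_space A x" "v \<in> tangent_space A x"
  shows metric_sym: "g x u v = g x v u"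
    and metric_scale: "g x (tv_scale a u) v = a * g x u v"
    and metric_add: "u' \<in> tangent_space A x \<Longrightarrow> g x (tv_add u u') v = g x u v + g x u' v"
    and metric_pos: "u \<noteq> tv_zero \<Longrightarrow> g x u u > 0"
  using metric assms unfolding riemannian_metric_def by blast+

lemma tv_norm_scale:
  assumes "v \<in> tangent_space A x"
  shows "tv_norm g x (tv_scale a v) = \<bar>a\<bar> * tv_norm g x v"
proof -
  have "g x (tv_scale a v) (tv_scale a v) = a * (a * g x v v)"
    using assms tv_scale_in[OF assms] by (metis metric_scale metric_sym)
  then show ?thesis
    by (simp add: tv_norm_def real_sqrt_mult mult.assoc[symmetric])
qed

lemma tv_norm_pos: "v \<in> tangent_space A x \<Longrightarrow> v \<noteq> tv_zero \<Longrightarrow> tv_norm g x v > 0"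
  unfolding tv_norm_def using metric_pos by simp

text \<open>
  On one tangent space the metric is a bilinear form in finitely many coordinates, hence bounded.
\<close>
lemma continuous_tv_norm:
  assumes c: "c \<in> charts_at A x"
  shows "continuous_on UNIV (\<lambda>u. tv_norm g x (tv_of_coords A c x u))"
proof -
  let ?E = "tv_of_coords A c x"
  note E = tv_of_coords_in[OF c] tv_of_coords_linear[OF c]
  have "bilinear (\<lambda>u v. g x (?E u) (?E v))"
    unfolding bilinear_def
  proof (intro conjI allI linearI)
    fix u v w :: "real ^ 'n" and r :: real
    show 1: "g x (?E (v + w)) (?E u) = g x (?E v) (?E u) + g x (?E w) (?E u)"
      and 2: "g x (?E (r *\<^sub>R v)) (?E u) = r *\<^sub>R g x (?E v) (?E u)"
      using metric_add metric_scale E by (simp_all add: E)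
    show "g x (?E u) (?E (v + w)) = g x (?E u) (?E v) + g x (?E u) (?E w)"
      "g x (?E u) (?E (r *\<^sub>R v)) = r *\<^sub>R g x (?E u) (?E v)"
      using 1 2 metric_sym E(1) by metis+
  qed
  then have "bounded_bilinear (\<lambda>u v. g x (?E u) (?E v))"
    by (simp add: bilinear_conv_bounded_bilinear)
  then show ?thesis
    unfolding tv_norm_def
    by (intro continuous_on_real_sqrt) (rule bounded_bilinear.continuous_on[OF _ continuous_on_id continuous_on_id])
qed

end
end

section \<open>Flows with an immersion by Koopman eigenfunctions\<close>

text \<open>
  Continuity of orbits in time and injectivity of the joint differential of the eigenfunctions are
  what the continuity, the differentiability and the group law of the time maps are derived from.
\<close>
locale koopman_immersion =
  fixes A :: "('m::{t2_space, second_countable_topology}, 'n::finite) chart set"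
    and \<psi> :: "real \<Rightarrow> 'm \<Rightarrow> 'm" and \<phi> :: "nat \<Rightarrow> 'm \<Rightarrow> complex" and lam :: "nat \<Rightarrow> complex"
  assumes atlas: "smooth_atlas A"
    and flow_zero: "\<psi> 0 x = x"
    and orbit: "continuous_on UNIV (\<lambda>t. \<psi> t x)"
    and C1: "j \<in> {1..CARD('n)} \<Longrightarrow> Ck_observable A 1 UNIV (\<phi> j)"
    and eigen: "j \<in> {1..CARD('n)} \<Longrightarrow> \<phi> j (\<psi> t x) = exp (lam j * of_real t) * \<phi> j x"
    and inj: "inj_on (\<lambda>v. \<lambda>j\<in>{1..CARD('n)}. differential A (\<phi> j) x v) (tangent_space A x)"
begin

text \<open>
  The eigenfunctions are numbered by naturals; numbering them by \<open>'n\<close> makes the target of \<open>\<Phi>\<close> the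
  Euclidean space \<open>complex ^ 'n\<close>.
\<close>
definition index :: "'n \<Rightarrow> nat" where
  "index = (SOME h. bij_betw h UNIV {1..CARD('n)})"

lemma index: "bij_betw index UNIV {1..CARD('n)}"
proof -
  have "\<exists>h. bij_betw h (UNIV :: 'n set) {1..CARD('n)}"
    by (intro finite_same_card_bij) auto
  then show ?thesis unfolding index_def by (rule someI_ex)
qed

lemma index_in: "index i \<in> {1..CARD('n)}"
  using index bij_betwE by blast

definition \<Phi> :: "'m \<Rightarrow> complex ^ 'n" where
  "\<Phi> x = (\<chi> i. \<phi> (index i) x)"

definition d\<Phi> :: "('m, 'n) chart \<Rightarrow> 'm \<Rightarrow> real ^ 'n \<Rightarrow> complex ^ 'n" where
  "d\<Phi> c x u = (\<chi> i. differential A (\<phi> (index i)) x (tv_of_coords A c x u))"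

lemma \<Phi>_has_derivative:
  assumes c: "c \<in> charts_at A x"
  shows "((\<Phi> \<circ> cinv c) has_derivative d\<Phi> c x) (at (cmap c x))"
proof -
  have "\<Phi> \<circ> cinv c = (\<lambda>p. \<chi> i. (\<phi> (index i) \<circ> cinv c) p)"
    by (simp add: \<Phi>_def fun_eq_iff)
  moreover have "d\<Phi> c x = (\<lambda>u. \<chi> i. differential A (\<phi> (index i)) x (tv_of_coords A c x u))"
    by (simp add: d\<Phi>_def fun_eq_iff)
  ultimately show ?thesis
    using Ck_observable_has_derivative[OF atlas C1[OF index_in] UNIV_I c]
    by (simp only:) (rule has_derivative_vec_lambda)
qed

lemma inj_d\<Phi>:
  assumes c: "c \<in> charts_at A x"
  shows "inj (d\<Phi> c x)"
proof (rule injI)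
  fix u v assume eq: "d\<Phi> c x u = d\<Phi> c x v"
  let ?u = "tv_of_coords A c x u" and ?v = "tv_of_coords A c x v"
  have "differential A (\<phi> j) x ?u = differential A (\<phi> j) x ?v" if j: "j \<in> {1..CARD('n)}" for j
  proof -
    obtain i where "j = index i" using index j by (metis bij_betw_imp_surj_on imageE)
    then show ?thesis using arg_cong[OF eq, of "\<lambda>z. z $ i"] by (simp add: d\<Phi>_def)
  qed
  then have "?u = ?v"
    using inj_onD[OF inj[of x] _ tv_of_coords_in[OF atlas c] tv_of_coords_in[OF atlas c]]
    by (metis (mono_tags, lifting) restrict_ext)
  then show "u = v" using tv_of_coords_apply[OF atlas c] by metis
qed

lemma \<Phi>_isCont: "isCont \<Phi> x"
  unfolding isCont_def \<Phi>_def
  using Ck_observable_isCont[OF atlas C1[OF index_in] UNIV_I, of x]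
  by (intro tendsto_vec_lambda) (simp add: isCont_def)

text \<open>
  In a chart \<open>\<Phi>\<close> is an immersion of class \<open>C\<^sup>1\<close>; the image of a small closed coordinate ball is a
  compact neighbourhood.
\<close>
lemma \<Phi>_locally_injective: "\<exists>B. compact B \<and> x \<in> interior B \<and> inj_on \<Phi> B"
proof -
  define c where "c = chart_at A x"
  have c: "c \<in> charts_at A x" unfolding c_def by (rule chart_at_in[OF atlas])
  define S where "S = cmap c ` cdom c"
  have S: "open S" "cmap c x \<in> S"
    using charts_atD[OF atlas c] by (auto simp: S_def)
  have c_at: "c \<in> charts_at A (cinv c p)" "cmap c (cinv c p) = p" if p: "p \<in> S" for p
  proof -
    obtain y where y: "y \<in> cdom c" "p = cmap c y" using p unfolding S_def by blast
    have "cinv c p = y" using charts_atD(5)[OF atlas c] y by (simp add: homeomorphism_apply1)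
    then show "c \<in> charts_at A (cinv c p)" "cmap c (cinv c p) = p"
      using y charts_atD(1)[OF atlas c] by (simp_all add: charts_at_def)
  qed
  have deriv: "((\<Phi> \<circ> cinv c) has_derivative d\<Phi> c (cinv c p)) (at p)" if "p \<in> S" for p
    using \<Phi>_has_derivative[OF c_at(1)[OF that]] c_at(2)[OF that] by simp
  have cont: "continuous_on S (\<lambda>p. d\<Phi> c (cinv c p) u)" for u
    unfolding d\<Phi>_def
  proof (intro continuous_on_vec_lambda)
    fix i
    have "Ck_on (Suc 0) (\<phi> (index i) \<circ> cinv c) (cmap c ` (cdom c \<inter> UNIV))"
      using C1[OF index_in] charts_atD(1)[OF atlas c] by (simp add: Ck_observable_def)
    then have "continuous_on S (\<lambda>p. frechet_derivative (\<phi> (index i) \<circ> cinv c) (at p) u)"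
      by (simp add: S_def)
    moreover have "frechet_derivative (\<phi> (index i) \<circ> cinv c) (at p) u =
        differential A (\<phi> (index i)) (cinv c p) (tv_of_coords A c (cinv c p) u)" if "p \<in> S" for p
      using frechet_derivative_at[OF Ck_observable_has_derivative[OF atlas C1[OF index_in] UNIV_I c_at(1)[OF that]]]
        c_at(2)[OF that] by metis
    ultimately show "continuous_on S (\<lambda>p. differential A (\<phi> (index i)) (cinv c p) (tv_of_coords A c (cinv c p) u))"
      by (metis (mono_tags, lifting) continuous_on_cong)
  qed
  have "inj (d\<Phi> c (cinv c (cmap c x)))"
    using inj_d\<Phi>[OF c] cinv_cmap[OF atlas c] by simp
  then obtain r where r: "r > 0" "ball (cmap c x) r \<subseteq> S" "inj_on (\<Phi> \<circ> cinv c) (ball (cmap c x) r)"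
    using C1_immersion_locally_injective[OF S deriv cont] by blast
  define C where "C = cball (cmap c x) (r/2)"
  have C: "C \<subseteq> ball (cmap c x) r" "C \<subseteq> S" "compact C"
    using r by (auto simp: C_def)
  have hom: "homeomorphism (cdom c) S (cmap c) (cinv c)"
    using charts_atD(5)[OF atlas c] by (simp add: S_def)
  define B where "B = cinv c ` C"
  have "compact B"
    unfolding B_def using C hom
    by (meson compact_continuous_image continuous_on_subset homeomorphism_cont2)
  moreover have "x \<in> interior B"
  proof (rule interiorI)
    let ?U = "cdom c \<inter> cmap c -` ball (cmap c x) (r/2)"
    show "open ?U"
      using charts_atD(3)[OF atlas c] hom by (meson continuous_open_preimage homeomorphism_cont1 open_ball)
    show "x \<in> ?U" using charts_atD(2)[OF atlas c] r(1) by simp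
    show "?U \<subseteq> B"
    proof
      fix y assume y: "y \<in> ?U"
      then have "cmap c y \<in> C" by (auto simp: C_def)
      moreover have "y = cinv c (cmap c y)" using hom y by (simp add: homeomorphism_apply1)
      ultimately show "y \<in> B" unfolding B_def by (rule rev_image_eqI)
    qed
  qed
  moreover have "inj_on \<Phi> B"
    unfolding B_def using inj_on_subset[OF r(3) C(1)] by (rule inj_on_imageI)
  ultimately show ?thesis by blast
qed

definition growth :: "real \<Rightarrow> complex ^ 'n \<Rightarrow> complex ^ 'n" where
  "growth t z = (\<chi> i. exp (lam (index i) * of_real t) * z $ i)"

lemma \<Phi>_flow: "\<Phi> (\<psi> t x) = growth t (\<Phi> x)"
  by (simp add: \<Phi>_def growth_def eigen[OF index_in])

lemma growth_diff: "growth t u - growth t v = growth t (u - v)"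
  by (simp add: growth_def vec_eq_iff algebra_simps)

lemma linear_growth: "linear (growth t)"
  by (rule linearI) (simp_all add: growth_def vec_eq_iff algebra_simps)

lemma growth_lipschitz:
  assumes "compact I"
  shows "\<exists>M. \<forall>t\<in>I. \<forall>u v. dist (growth t u) (growth t v) \<le> M * dist u v"
proof -
  define m where "m t = (\<Sum>i\<in>UNIV. cmod (exp (lam (index i) * of_real t)))" for t
  have "compact (m ` I)"
    unfolding m_def by (intro compact_continuous_image[OF _ assms] continuous_intros)
  then obtain M where M: "\<And>t. t \<in> I \<Longrightarrow> m t \<le> M"
    by (metis compact_imp_bounded bounded_real abs_le_D1 imageI)
  have "norm (growth t z) \<le> M * norm z" if "t \<in> I" for t z
  proof -
    have "norm (growth t z) \<le> (\<Sum>i\<in>UNIV. norm (growth t z $ i))"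
      by (simp add: norm_vec_def L2_set_le_sum)
    also have "\<dots> = (\<Sum>i\<in>UNIV. cmod (exp (lam (index i) * of_real t)) * norm (z $ i))"
      by (simp only: growth_def norm_mult vec_lambda_beta)
    also have "\<dots> \<le> (\<Sum>i\<in>UNIV. cmod (exp (lam (index i) * of_real t)) * norm z)"
      by (intro sum_mono mult_left_mono Finite_Cartesian_Product.norm_nth_le) auto
    also have "\<dots> = m t * norm z" by (simp only: m_def sum_distrib_right)
    also have "\<dots> \<le> M * norm z" by (intro mult_right_mono M that) auto
    finally show ?thesis .
  qed
  then show ?thesis by (auto simp: dist_norm growth_diff)
qed

lemma flow_isCont: "isCont (\<psi> t) x"
proof (rule semiconjugate_flow_continuous[of \<Phi> \<psi> growth])
  show "continuous_on UNIV \<Phi>" using \<Phi>_isCont by (simp add: continuous_on_eq_continuous_at)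
qed (use \<Phi>_locally_injective flow_zero orbit \<Phi>_flow growth_lipschitz in auto)

text \<open>
  In charts, \<open>\<Phi>\<close> after the time map is \<open>growth t\<close> after \<open>\<Phi>\<close>, which is differentiable; the
  immersion \<open>\<Phi>\<close> on the left is cancelled.
\<close>
lemma flow_differentiable:
  assumes c: "c \<in> charts_at A x" and d: "d \<in> charts_at A (\<psi> t x)"
  shows "(cmap d \<circ> \<psi> t \<circ> cinv c) differentiable (at (cmap c x))"
proof -
  define G where "G = cmap d \<circ> \<psi> t \<circ> cinv c"
  have Gx: "G (cmap c x) = cmap d (\<psi> t x)" by (simp add: G_def cinv_cmap[OF atlas c])
  have 1: "isCont (\<psi> t \<circ> cinv c) (cmap c x)"
    by (intro isCont_comp isCont_cinv[OF atlas c]) (simp add: cinv_cmap[OF atlas c] flow_isCont)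
  have G: "isCont G (cmap c x)"
    unfolding G_def comp_assoc
    by (rule isCont_comp[OF 1]) (simp add: cinv_cmap[OF atlas c] isCont_cmap[OF atlas d])
  have "((\<lambda>p. growth t ((\<Phi> \<circ> cinv c) p)) has_derivative (\<lambda>u. growth t (d\<Phi> c x u))) (at (cmap c x))"
  proof (rule bounded_linear.has_derivative[OF _ \<Phi>_has_derivative[OF c]])
    show "bounded_linear (growth t)"
      using linear_growth by (simp only: linear_conv_bounded_linear)
  qed
  moreover have "\<forall>\<^sub>F p in nhds (cmap c x). growth t ((\<Phi> \<circ> cinv c) p) = (\<Phi> \<circ> cinv d) (G p)"
  proof -
    have "\<forall>\<^sub>F p in nhds (cmap c x). (\<psi> t \<circ> cinv c) p \<in> cdom d"
      using topological_tendstoD[OF 1[unfolded isCont_iff_tendsto_nhds] charts_atD(3)[OF atlas d]]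
        charts_atD(2)[OF atlas d] by (simp add: cinv_cmap[OF atlas c])
    then show ?thesis
      by eventually_elim (simp add: G_def \<Phi>_flow homeomorphism_apply1[OF charts_atD(5)[OF atlas d]])
  qed
  ultimately have "((\<lambda>p. (\<Phi> \<circ> cinv d) (G p)) has_derivative (\<lambda>u. growth t (d\<Phi> c x u))) (at (cmap c x))"
    by (rule has_derivative_transform_eventually_nhds)
  from has_derivative_cancel_immersion[OF _ inj_d\<Phi>[OF d] G this]
  have "G differentiable (at (cmap c x))"
    using \<Phi>_has_derivative[OF d] by (simp only: Gx)
  then show ?thesis by (simp add: G_def)
qed

lemma flow_tangent_in:
  "v \<in> tangent_space A x \<Longrightarrow> tangent_map A (\<psi> t) x v \<in> tangent_space A (\<psi> t x)"
  by (intro tangent_map_in[OF atlas] flow_isCont flow_differentiable chart_at_in[OF atlas])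

text \<open>The derivative of the eigenfunction equation.\<close>
lemma differential_flow:
  assumes j: "j \<in> {1..CARD('n)}" and v: "v \<in> tangent_space A x"
  shows "differential A (\<phi> j) (\<psi> t x) (tangent_map A (\<psi> t) x v)
    = exp (lam j * of_real t) * differential A (\<phi> j) x v"
proof -
  let ?c = "chart_at A x"
  note c = chart_at_in[OF atlas, of x]
  have "differential A (\<phi> j) (\<psi> t x) (tangent_map A (\<psi> t) x v) = differential A (\<phi> j \<circ> \<psi> t) x v"
    using differential_tangent_map[OF atlas flow_isCont flow_differentiable[OF c] v C1[OF j]] .
  moreover have "\<phi> j \<circ> \<psi> t \<circ> cinv ?c = (\<lambda>p. exp (lam j * of_real t) * (\<phi> j \<circ> cinv ?c) p)"
    by (simp add: fun_eq_iff eigen[OF j])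
  then have "((\<phi> j \<circ> \<psi> t \<circ> cinv ?c) has_derivative
      (\<lambda>u. exp (lam j * of_real t) * differential A (\<phi> j) x (tv_of_coords A ?c x u))) (at (cmap ?c x))"
    using has_derivative_mult_right[OF Ck_observable_has_derivative[OF atlas C1[OF j] UNIV_I c]]
    by simp
  from differential_eq[OF atlas c this v]
  have "differential A (\<phi> j \<circ> \<psi> t) x v = exp (lam j * of_real t) * differential A (\<phi> j) x v"
    by (simp add: tv_of_coords_of[OF atlas c v])
  ultimately show ?thesis by simp
qed

text \<open>
  Both sides are curves in \<open>s\<close> through \<open>\<psi> t x\<close>, and \<open>\<Phi>\<close> maps them to the same curve by the law of
  exponents.
\<close>
lemma flow_group: "\<psi> s (\<psi> t x) = \<psi> (s + t) x"
proof (rule lifts_agree[of \<Phi> "\<lambda>s. \<psi> s (\<psi> t x)" "\<lambda>s. \<psi> (s + t) x" 0])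
  show "\<exists>B. p \<in> interior B \<and> inj_on \<Phi> B" for p using \<Phi>_locally_injective by blast
  show "continuous_on UNIV (\<lambda>s. \<psi> s (\<psi> t x))" by (rule orbit)
  show "continuous_on UNIV (\<lambda>s. \<psi> (s + t) x)"
    by (rule continuous_on_compose2[OF orbit]) (auto intro: continuous_intros)
  show "\<Phi> (\<psi> s (\<psi> t x)) = \<Phi> (\<psi> (s + t) x)" for s
    by (simp add: \<Phi>_def eigen[OF index_in] exp_add distrib_left distrib_right mult.assoc)
qed (simp add: flow_zero)

end

section \<open>Cones on which one eigenfunction dominates\<close>

text \<open>
  The real form \<open>a\<close> is the differential of \<open>\<phi> 1\<close> divided by the complex factor \<open>\<eta>\<close>.  The condition
  \<open>\<eta>_flow\<close> says that the factor takes up the phase of \<open>exp (lam 1 * t)\<close>, so that \<open>a\<close> itself is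
  multiplied by a positive number.  This covers at once a real leading eigenfunction (\<open>\<eta> = 1\<close>) and
  the argument of one with constant modulus (\<open>\<eta> = \<i> * \<phi> 1\<close>).
\<close>
locale dominated_immersion = koopman_immersion A \<psi> \<phi> lam
  for A :: "('m::{t2_space, second_countable_topology}, 'n::finite) chart set"
    and \<psi> :: "real \<Rightarrow> 'm \<Rightarrow> 'm" and \<phi> :: "nat \<Rightarrow> 'm \<Rightarrow> complex" and lam :: "nat \<Rightarrow> complex" +
  fixes a :: "'m \<Rightarrow> ('m, 'n) tvec \<Rightarrow> real" and \<eta> :: "'m \<Rightarrow> complex"
  assumes gap: "j \<in> {2..CARD('n)} \<Longrightarrow> Re (lam j) < Re (lam 1)"
    and a: "v \<in> tangent_space A x \<Longrightarrow> differential A (\<phi> 1) x v = of_real (a x v) * \<eta> x"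
    and \<eta>_nonzero: "\<eta> x \<noteq> 0"
    and \<eta>_flow: "exp (lam 1 * of_real t) * \<eta> x = of_real (exp (Re (lam 1) * t)) * \<eta> (\<psi> t x)"
    and solid_cone: "cone_field A (eigenfunction_cone A \<phi> a)"
begin

abbreviation b :: "nat \<Rightarrow> 'm \<Rightarrow> ('m, 'n) tvec \<Rightarrow> complex" where
  "b j \<equiv> differential A (\<phi> j)"

text \<open>The aperture \<open>\<rho> = 1\<close> is the cone of the eigenfunctions, smaller \<open>\<rho>\<close> give narrower cones.\<close>
definition dominance_cone :: "real \<Rightarrow> 'm \<Rightarrow> ('m, 'n) tvec set" where
  "dominance_cone \<rho> x = {v \<in> tangent_space A x. \<forall>j\<in>{2..CARD('n)}. cmod (b j x v) \<le> \<rho> * a x v}"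

lemma dominance_cone_one: "dominance_cone 1 = eigenfunction_cone A \<phi> a"
  by (simp add: dominance_cone_def eigenfunction_cone_def fun_eq_iff)

text \<open>The spectral gap, capped at \<open>1\<close> so that the minimum is visibly over a nonempty set.\<close>
definition \<mu> :: real where
  "\<mu> = Min (insert 1 ((\<lambda>j. Re (lam 1) - Re (lam j)) ` {2..CARD('n)}))"

lemma \<mu>_pos: "\<mu> > 0"
  unfolding \<mu>_def using gap by (subst Min_gr_iff) auto

lemma \<mu>_gap: "j \<in> {2..CARD('n)} \<Longrightarrow> Re (lam j) \<le> Re (lam 1) - \<mu>"
proof -
  assume "j \<in> {2..CARD('n)}"
  then have "\<mu> \<le> Re (lam 1) - Re (lam j)"
    unfolding \<mu>_def by (intro Min_le) auto
  then show ?thesis by simp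
qed

lemma exp_decay: "((\<lambda>t. exp (- \<mu> * t)) \<longlongrightarrow> 0) at_top"
  using \<mu>_pos
  by (intro filterlim_compose[OF exp_at_bot] filterlim_tendsto_neg_mult_at_bot[OF tendsto_const] filterlim_ident) auto

abbreviation E :: "'m \<Rightarrow> real ^ 'n \<Rightarrow> ('m, 'n) tvec" where
  "E x \<equiv> tv_of_coords A (chart_at A x) x"

lemmas chart = chart_at_in[OF atlas]
lemmas E_in = tv_of_coords_in[OF atlas chart]
  and E_apply = tv_of_coords_apply[OF atlas chart]
  and E_of = tv_of_coords_of[OF atlas chart]
  and E_linear = tv_of_coords_linear[OF atlas chart]

lemma one_in: "1 \<in> {1..CARD('n)}"
  by (simp add: Suc_le_eq)

lemma tail_in: "j \<in> {2..CARD('n)} \<Longrightarrow> j \<in> {1..CARD('n)}"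
  by simp

lemma linear_b: "j \<in> {1..CARD('n)} \<Longrightarrow> linear (\<lambda>u. b j x (E x u))"
  by (rule differential_linear[OF atlas C1 chart])

lemma a_eq: "v \<in> tangent_space A x \<Longrightarrow> a x v = Re (b 1 x v / \<eta> x)"
  using a[of v x] \<eta>_nonzero[of x] by simp

lemma linear_a: "linear (\<lambda>u. a x (E x u))"
proof (rule linearI)
  note lin = linear_b[OF one_in, of x]
  show "a x (E x (u + v)) = a x (E x u) + a x (E x v)" for u v
    using linear_add[OF lin, of u v] by (simp add: a_eq E_in add_divide_distrib)
  show "a x (E x (r *\<^sub>R u)) = r *\<^sub>R a x (E x u)" for r u
  proof -
    have "Re (r *\<^sub>R z / \<eta> x) = r * Re (z / \<eta> x)" for z
      using scaleR_complex.sel(1)[of r "z / \<eta> x"] by (simp add: scaleR_conv_of_real)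
    then show ?thesis
      using linear_scale[OF lin, of r u] by (simp only: a_eq[OF E_in] real_scaleR_def)
  qed
qed

lemma tv_add_E: "u \<in> tangent_space A x \<Longrightarrow> v \<in> tangent_space A x \<Longrightarrow>
    tv_add u v = E x (u (chart_at A x) + v (chart_at A x))"
  by (simp add: E_linear E_of)

lemma tv_scale_E: "v \<in> tangent_space A x \<Longrightarrow> tv_scale r v = E x (r *\<^sub>R v (chart_at A x))"
  by (simp add: E_linear E_of)

lemma a_add: "u \<in> tangent_space A x \<Longrightarrow> v \<in> tangent_space A x \<Longrightarrow> a x (tv_add u v) = a x u + a x v"
  by (simp add: tv_add_E linear_add[OF linear_a] E_of)

lemma a_scale: "v \<in> tangent_space A x \<Longrightarrow> a x (tv_scale r v) = r * a x v"
  by (simp add: tv_scale_E linear_scale[OF linear_a] E_of)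

lemma b_add: "j \<in> {2..CARD('n)} \<Longrightarrow> u \<in> tangent_space A x \<Longrightarrow> v \<in> tangent_space A x \<Longrightarrow>
    b j x (tv_add u v) = b j x u + b j x v"
  by (simp add: tv_add_E linear_add[OF linear_b[OF tail_in]] E_of)

lemma b_scale: "j \<in> {2..CARD('n)} \<Longrightarrow> v \<in> tangent_space A x \<Longrightarrow> b j x (tv_scale r v) = r *\<^sub>R b j x v"
  by (simp only: tv_scale_E linear_scale[OF linear_b[OF tail_in]] E_of)

text \<open>
  If \<open>a\<close> vanishes on a vector then so does the differential of \<open>\<phi> 1\<close>, being a multiple of \<open>a\<close>;
  injectivity of all differentials together does the rest.
\<close>
lemma nondegenerate:
  assumes v: "v \<in> tangent_space A x" and "a x v = 0" "\<And>j. j \<in> {2..CARD('n)} \<Longrightarrow> b j x v = 0"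
  shows "v = tv_zero"
proof -
  have zero: "b j x tv_zero = 0" if "j \<in> {1..CARD('n)}" for j
  proof -
    have "E x 0 = tv_zero" using tv_scale_E[OF tv_zero_in[OF atlas], of 0 x] by (simp add: tv_scale_def tv_zero_def)
    then show ?thesis using linear_0[OF linear_b[OF that, of x]] by simp
  qed
  have "b j x v = 0" if j: "j \<in> {1..CARD('n)}" for j
  proof (cases "j = 1")
    case True
    then show ?thesis using a[OF v] assms(2) by simp
  next
    case False
    then show ?thesis using assms(3)[of j] j by auto
  qed
  then have "(\<lambda>j\<in>{1..CARD('n)}. b j x v) = (\<lambda>j\<in>{1..CARD('n)}. b j x tv_zero)"
    using zero by (intro restrict_ext) simp
  then show ?thesis using inj_onD[OF inj _ v tv_zero_in[OF atlas]] by blast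
qed

lemma zero_in_dominance_cone: "tv_zero \<in> dominance_cone \<rho> x"
proof -
  have z: "tv_scale 0 tv_zero = (tv_zero :: ('m,'n) tvec)" by (simp add: tv_scale_def tv_zero_def)
  have "a x tv_zero = 0" "\<And>j. j \<in> {2..CARD('n)} \<Longrightarrow> b j x tv_zero = 0"
    using a_scale[OF tv_zero_in[OF atlas], of x 0] b_scale[OF _ tv_zero_in[OF atlas], of _ x 0] by (simp_all add: z)
  then show ?thesis using tv_zero_in[OF atlas] by (simp add: dominance_cone_def)
qed

text \<open>
  In dimension one no condition would be imposed and the cone would be a whole line, which is not
  pointed.
\<close>
lemma two_in: "2 \<in> {2..CARD('n)}"
proof (rule ccontr)
  assume "2 \<notin> {2..CARD('n)}"
  then have empty: "{2..CARD('n)} = {}" by auto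
  fix x :: 'm and i :: 'n
  let ?v = "E x (axis i 1)"
  have K: "eigenfunction_cone A \<phi> a x = tangent_space A x"
    unfolding eigenfunction_cone_def empty by simp
  have "?v = tv_scale (-1) (tv_scale (-1) ?v)" by (simp add: tv_scale_def)
  then have "?v \<in> tangent_space A x \<inter> tv_scale (-1) ` tangent_space A x"
    using E_in tv_scale_in[OF atlas] by blast
  then have "?v = tv_zero" using solid_cone K unfolding cone_field_def by blast
  then have "axis i (1::real) = 0" using E_apply[of x "axis i 1"] by (simp add: tv_zero_def)
  then show False by (simp add: axis_eq_0_iff)
qed

text \<open>Some \<open>j \<ge> 2\<close> exists, and the modulus of its differential bounds \<open>\<rho> * a\<close> below by zero.\<close>
lemma dominance_cone_nonneg: "\<rho> > 0 \<Longrightarrow> v \<in> dominance_cone \<rho> x \<Longrightarrow> a x v \<ge> 0"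
proof -
  assume "\<rho> > 0" "v \<in> dominance_cone \<rho> x"
  then have "0 \<le> \<rho> * a x v" using two_in norm_ge_zero order_trans unfolding dominance_cone_def by blast
  then show ?thesis using \<open>\<rho> > 0\<close> by (simp add: zero_le_mult_iff)
qed

lemma dominance_cone_pos:
  assumes "\<rho> > 0" "v \<in> dominance_cone \<rho> x" "v \<noteq> tv_zero"
  shows "a x v > 0"
proof (rule ccontr)
  assume "\<not> a x v > 0"
  then have 0: "a x v = 0" using dominance_cone_nonneg[OF assms(1,2)] by simp
  moreover have "b j x v = 0" if "j \<in> {2..CARD('n)}" for j
    using assms(2) that 0 by (auto simp: dominance_cone_def)
  ultimately show False using nondegenerate assms(2,3) by (simp add: dominance_cone_def)
qed

lemma a_flow:
  assumes v: "v \<in> tangent_space A x"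
  shows "a (\<psi> t x) (tangent_map A (\<psi> t) x v) = exp (Re (lam 1) * t) * a x v"
proof -
  have "of_real (a (\<psi> t x) (tangent_map A (\<psi> t) x v)) * \<eta> (\<psi> t x)
      = exp (lam 1 * of_real t) * (of_real (a x v) * \<eta> x)"
    using differential_flow[OF one_in v, of t] a[OF v] a[OF flow_tangent_in[OF v]] by simp
  also have "\<dots> = of_real (a x v) * (exp (lam 1 * of_real t) * \<eta> x)" by simp
  also have "\<dots> = of_real (exp (Re (lam 1) * t) * a x v) * \<eta> (\<psi> t x)"
    unfolding \<eta>_flow by simp
  finally show ?thesis using \<eta>_nonzero by (simp only: mult_cancel_right of_real_eq_iff) simp
qed

text \<open>
  The contraction behind everything else: relative to \<open>a\<close>, the other differentials shrink at
  least by the factor \<open>exp (- \<mu> * t)\<close>.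
\<close>
lemma dominance_cone_flow:
  assumes v: "v \<in> dominance_cone 1 x" and t: "t \<ge> 0"
  shows "tangent_map A (\<psi> t) x v \<in> dominance_cone (exp (- \<mu> * t)) (\<psi> t x)"
proof -
  have vT: "v \<in> tangent_space A x" using v by (simp add: dominance_cone_def)
  have "cmod (b j (\<psi> t x) (tangent_map A (\<psi> t) x v)) \<le> exp (- \<mu> * t) * a (\<psi> t x) (tangent_map A (\<psi> t) x v)"
    if j: "j \<in> {2..CARD('n)}" for j
  proof -
    have "cmod (b j (\<psi> t x) (tangent_map A (\<psi> t) x v)) = exp (Re (lam j) * t) * cmod (b j x v)"
      using differential_flow[OF tail_in[OF j] vT] by (simp add: norm_mult)
    also have "\<dots> \<le> exp ((Re (lam 1) - \<mu>) * t) * a x v"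
      using \<mu>_gap[OF j] t v j by (intro mult_mono) (auto simp: dominance_cone_def intro: mult_right_mono)
    also have "\<dots> = exp (- \<mu> * t) * (exp (Re (lam 1) * t) * a x v)"
      by (simp add: exp_add[symmetric] algebra_simps)
    finally show ?thesis using a_flow[OF vT] by simp
  qed
  then show ?thesis using flow_tangent_in[OF vT] by (simp add: dominance_cone_def)
qed

lemma dominance_cone_nonzero_exists: "\<exists>v\<in>dominance_cone 1 x. v \<noteq> tv_zero"
  unfolding dominance_cone_one
  by (rule nonzero_in_solid_set[OF atlas]) (use solid_cone in \<open>auto simp: cone_field_def\<close>)

lemma flow_tangent_nonzero:
  assumes "v \<in> dominance_cone 1 x" "v \<noteq> tv_zero"
  shows "a (\<psi> t x) (tangent_map A (\<psi> t) x v) > 0"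
  using a_flow[of v x t] dominance_cone_pos[OF _ assms] assms(1) by (simp add: dominance_cone_def)

lemma norm_bound:
  obtains B where "B > 0" "\<And>u. norm u \<le> B * (\<bar>a x (E x u)\<bar> + (\<Sum>j\<in>{2..CARD('n)}. cmod (b j x (E x u))))"
proof (rule jointly_injective_norm_bound[of "\<lambda>u. a x (E x u)" "{2..CARD('n)}" "\<lambda>j u. b j x (E x u)"])
  fix u assume "a x (E x u) = 0" "\<And>j. j \<in> {2..CARD('n)} \<Longrightarrow> b j x (E x u) = 0"
  then have "E x u = tv_zero" using nondegenerate[OF E_in] by blast
  then show "u = 0" using E_apply[of x u] by (simp add: tv_zero_def)
qed (use linear_a linear_b tail_in that in auto)

text \<open>
  The common kernel of \<open>d (\<phi> j)\<close>, \<open>j \<ge> 2\<close>, cannot be found by counting dimensions, since the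
  \<open>CARD('n) - 1\<close> complex equations are up to twice as many real ones.  It is produced by the
  dynamics: the cones at the points \<open>\<psi> (- k) x\<close> contain nonzero vectors, and their images at \<open>x\<close>,
  scaled to \<open>a = 1\<close>, form a bounded sequence along which each \<open>d (\<phi> j)\<close> tends to zero.
\<close>
lemma dominant_vector_exists: "\<exists>w\<in>tangent_space A x. a x w = 1 \<and> (\<forall>j\<in>{2..CARD('n)}. b j x w = 0)"
proof -
  have "\<exists>q. a x (E x q) = 1 \<and> (\<forall>j\<in>{2..CARD('n)}. cmod (b j x (E x q)) \<le> exp (- \<mu> * real k))" for k :: nat
  proof -
    let ?y = "\<psi> (- real k) x"
    obtain v where v: "v \<in> dominance_cone 1 ?y" "v \<noteq> tv_zero" using dominance_cone_nonzero_exists by blast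
    define p where "p = tangent_map A (\<psi> (real k)) ?y v"
    have ret: "\<psi> (real k) ?y = x" by (simp add: flow_group flow_zero)
    have p: "p \<in> dominance_cone (exp (- \<mu> * real k)) x" "a x p > 0"
      using dominance_cone_flow[OF v(1), of "real k"] flow_tangent_nonzero[OF v, of "real k"] by (simp_all add: p_def ret)
    have pT: "p \<in> tangent_space A x" using p(1) by (simp add: dominance_cone_def)
    define q where "q = (1 / a x p) *\<^sub>R p (chart_at A x)"
    have q: "E x q = tv_scale (1 / a x p) p" using tv_scale_E[OF pT] by (simp add: q_def)
    have "a x (E x q) = 1" using p(2) by (simp add: q a_scale[OF pT])
    moreover have "cmod (b j x (E x q)) \<le> exp (- \<mu> * real k)" if "j \<in> {2..CARD('n)}" for j
      using p that by (auto simp: q b_scale[OF _ pT] dominance_cone_def field_simps)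
    ultimately show ?thesis by blast
  qed
  then obtain q where q: "\<And>k::nat. a x (E x (q k)) = 1"
    "\<And>k j. j \<in> {2..CARD('n)} \<Longrightarrow> cmod (b j x (E x (q k))) \<le> exp (- \<mu> * real k)"
    by metis
  obtain B where B: "B > 0" "\<And>u. norm u \<le> B * (\<bar>a x (E x u)\<bar> + (\<Sum>j\<in>{2..CARD('n)}. cmod (b j x (E x u))))"
    using norm_bound by blast
  have "q k \<in> cball 0 (B * (1 + real (card {2..CARD('n)})))" for k
  proof -
    have "(\<Sum>j\<in>{2..CARD('n)}. cmod (b j x (E x (q k)))) \<le> (\<Sum>j\<in>{2..CARD('n)}. 1)"
    proof (intro sum_mono)
      fix j assume "j \<in> {2..CARD('n)}"
      have "exp (- \<mu> * real k) \<le> 1" using \<mu>_pos by simp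
      then show "cmod (b j x (E x (q k))) \<le> 1" using q(2)[OF \<open>j \<in> {2..CARD('n)}\<close>, of k] by linarith
    qed
    then have "\<bar>a x (E x (q k))\<bar> + (\<Sum>j\<in>{2..CARD('n)}. cmod (b j x (E x (q k)))) \<le> 1 + real (card {2..CARD('n)})"
      by (simp add: q(1))
    then show ?thesis using B(2)[of "q k"] mult_left_mono[OF _ less_imp_le[OF B(1)]]
      by (fastforce intro: order_trans)
  qed
  then obtain l r where l: "strict_mono r" "(q \<circ> r) \<longlonglongrightarrow> l"
    using compact_cball[unfolded compact_def, rule_format] by metis
  have lim: "(\<lambda>k. h (q (r k))) \<longlonglongrightarrow> h l" if "linear h" for h :: "real ^ 'n \<Rightarrow> 'z::euclidean_space"
    using bounded_linear.tendsto[OF _ l(2)] that by (simp add: linear_conv_bounded_linear)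
  have "a x (E x l) = 1"
    using lim[OF linear_a[of x]] by (simp add: q(1) LIMSEQ_const_iff)
  moreover have "b j x (E x l) = 0" if j: "j \<in> {2..CARD('n)}" for j
  proof -
    have "(\<lambda>k. exp (- \<mu> * real k)) \<longlonglongrightarrow> 0"
      using filterlim_compose[OF exp_decay filterlim_real_sequentially] .
    then have "(\<lambda>k. exp (- \<mu> * real (r k))) \<longlonglongrightarrow> 0"
      using LIMSEQ_subseq_LIMSEQ[OF _ l(1)] by (fastforce simp: o_def)
    then have "(\<lambda>k. b j x (E x (q (r k)))) \<longlonglongrightarrow> 0"
      by (rule Lim_null_comparison[rotated]) (intro always_eventually allI q(2)[OF j])
    then show ?thesis using lim[OF linear_b[OF tail_in[OF j], of x]] LIMSEQ_unique by blast
  qed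
  ultimately show ?thesis using E_in by blast
qed

definition dominant :: "'m \<Rightarrow> ('m, 'n) tvec" where
  "dominant x = (SOME w. w \<in> tangent_space A x \<and> a x w = 1 \<and> (\<forall>j\<in>{2..CARD('n)}. b j x w = 0))"

lemma dominant: "dominant x \<in> tangent_space A x" "a x (dominant x) = 1" "j \<in> {2..CARD('n)} \<Longrightarrow> b j x (dominant x) = 0"
proof -
  have "\<exists>w. w \<in> tangent_space A x \<and> a x w = 1 \<and> (\<forall>j\<in>{2..CARD('n)}. b j x w = 0)"
    using dominant_vector_exists by blast
  from someI_ex[OF this]
  show "dominant x \<in> tangent_space A x" "a x (dominant x) = 1" "j \<in> {2..CARD('n)} \<Longrightarrow> b j x (dominant x) = 0"
    by (auto simp: dominant_def)
qed

text \<open>The difference of the two sides is killed by \<open>a\<close> as well as by all \<open>d (\<phi> j)\<close>, \<open>j \<ge> 2\<close>.\<close>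
lemma annihilated_imp_multiple:
  assumes v: "v \<in> tangent_space A x" and "\<And>j. j \<in> {2..CARD('n)} \<Longrightarrow> b j x v = 0"
  shows "v = tv_scale (a x v) (dominant x)"
proof -
  let ?d = "tv_add v (tv_scale (- a x v) (dominant x))"
  note s = tv_scale_in[OF atlas dominant(1)]
  have "?d = tv_zero"
    by (rule nondegenerate[of _ x])
       (simp_all add: tv_add_in[OF atlas v s] a_add[OF v s] a_scale[OF dominant(1)] b_add[OF _ v s]
          b_scale[OF _ dominant(1)] dominant assms(2))
  then show ?thesis by (auto simp: tv_add_def tv_scale_def tv_zero_def fun_eq_iff dest: spec)
qed

lemma strict_dominance_cone_interior:
  assumes "v \<in> tangent_space A x" "\<forall>j\<in>{2..CARD('n)}. cmod (b j x v) < \<rho> * a x v"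
  shows "v \<in> tv_interior A x (dominance_cone \<rho> x)"
proof -
  let ?S = "{v \<in> tangent_space A x. \<forall>j\<in>{2..CARD('n)}. cmod (b j x v) < \<rho> * a x v}"
  have cont: "continuous_on UNIV (\<lambda>u. b j x (E x u))" if "j \<in> {2..CARD('n)}" for j
    using linear_b[OF tail_in[OF that]] by (simp add: linear_continuous_on linear_conv_bounded_linear)
  have cont_a: "continuous_on UNIV (\<lambda>u. a x (E x u))"
    using linear_a by (simp add: linear_continuous_on linear_conv_bounded_linear)
  have "open (\<Inter>j\<in>{2..CARD('n)}. {u. cmod (b j x (E x u)) < \<rho> * a x (E x u)})"
    using cont cont_a by (intro open_INT ballI open_Collect_less continuous_intros) auto
  also have "(\<Inter>j\<in>{2..CARD('n)}. {u. cmod (b j x (E x u)) < \<rho> * a x (E x u)}) =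
      {u. \<forall>j\<in>{2..CARD('n)}. cmod (b j x (E x u)) < \<rho> * a x (E x u)}" by auto
  finally have "openin (top_of_set (tangent_space A x)) ?S"
    by (rule openin_tangent_space[OF atlas chart])
  moreover have "?S \<subseteq> dominance_cone \<rho> x" by (auto simp: dominance_cone_def intro: less_imp_le)
  ultimately have "?S \<subseteq> tv_interior A x (dominance_cone \<rho> x)"
    unfolding tv_interior_def by (intro interior_of_maximal)
  then show ?thesis using assms by blast
qed

text \<open>
  The interior is nonempty for every aperture because it contains the dominant vector; pointedness
  holds because \<open>a\<close> is positive on nonzero vectors of the cone.
\<close>
lemma cone_field_dominance_cone:
  assumes "\<rho> > 0"
  shows "cone_field A (dominance_cone \<rho>)"
  unfolding cone_field_def
proof (intro allI conjI ballI impI)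
  fix x
  show "dominance_cone \<rho> x \<subseteq> tangent_space A x" by (auto simp: dominance_cone_def)
  have cont: "continuous_on UNIV (\<lambda>u. b j x (E x u))" if "j \<in> {2..CARD('n)}" for j
    using linear_b[OF tail_in[OF that]] by (simp add: linear_continuous_on linear_conv_bounded_linear)
  have cont_a: "continuous_on UNIV (\<lambda>u. a x (E x u))"
    using linear_a by (simp add: linear_continuous_on linear_conv_bounded_linear)
  have "closed (\<Inter>j\<in>{2..CARD('n)}. {u. cmod (b j x (E x u)) \<le> \<rho> * a x (E x u)})"
    using cont cont_a by (intro closed_INT ballI closed_Collect_le continuous_intros) auto
  also have "(\<Inter>j\<in>{2..CARD('n)}. {u. cmod (b j x (E x u)) \<le> \<rho> * a x (E x u)}) =
      {u. \<forall>j\<in>{2..CARD('n)}. cmod (b j x (E x u)) \<le> \<rho> * a x (E x u)}" by auto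
  finally show "closedin (top_of_set (tangent_space A x)) (dominance_cone \<rho> x)"
    unfolding dominance_cone_def by (rule closedin_tangent_space[OF atlas chart])
  have "dominant x \<in> tv_interior A x (dominance_cone \<rho> x)"
    using assms by (intro strict_dominance_cone_interior) (simp_all add: dominant)
  then show "tv_interior A x (dominance_cone \<rho> x) \<noteq> {}" by blast
  show "tv_add u v \<in> dominance_cone \<rho> x" if "u \<in> dominance_cone \<rho> x" "v \<in> dominance_cone \<rho> x" for u v
  proof -
    have T: "u \<in> tangent_space A x" "v \<in> tangent_space A x" using that by (simp_all add: dominance_cone_def)
    have "cmod (b j x (tv_add u v)) \<le> \<rho> * a x (tv_add u v)" if j: "j \<in> {2..CARD('n)}" for j
    proof -
      have "cmod (b j x u) \<le> \<rho> * a x u" "cmod (b j x v) \<le> \<rho> * a x v"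
        using that \<open>u \<in> dominance_cone \<rho> x\<close> \<open>v \<in> dominance_cone \<rho> x\<close> by (auto simp: dominance_cone_def)
      then show ?thesis
        unfolding b_add[OF j T] a_add[OF T] distrib_left by (intro norm_triangle_le add_mono)
    qed
    then show ?thesis using tv_add_in[OF atlas T] by (simp add: dominance_cone_def)
  qed
  show "tv_scale r v \<in> dominance_cone \<rho> x" if "r > 0" "v \<in> dominance_cone \<rho> x" for r v
  proof -
    have T: "v \<in> tangent_space A x" using that by (simp add: dominance_cone_def)
    have "cmod (b j x (tv_scale r v)) \<le> \<rho> * a x (tv_scale r v)" if j: "j \<in> {2..CARD('n)}" for j
    proof -
      have "r * cmod (b j x v) \<le> r * (\<rho> * a x v)"
        using \<open>r > 0\<close> \<open>v \<in> dominance_cone \<rho> x\<close> j by (intro mult_left_mono) (auto simp: dominance_cone_def)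
      then show ?thesis
        using \<open>r > 0\<close> by (simp add: b_scale[OF j T] a_scale[OF T] algebra_simps)
    qed
    then show ?thesis using tv_scale_in[OF atlas T] by (simp add: dominance_cone_def)
  qed
  show "dominance_cone \<rho> x \<inter> tv_scale (- 1) ` dominance_cone \<rho> x = {tv_zero}"
  proof (intro equalityI subsetI)
    fix v assume "v \<in> dominance_cone \<rho> x \<inter> tv_scale (- 1) ` dominance_cone \<rho> x"
    then obtain u where u: "v \<in> dominance_cone \<rho> x" "u \<in> dominance_cone \<rho> x" "v = tv_scale (-1) u" by blast
    then have "a x v = - a x u" using a_scale[of u x "-1"] by (simp add: dominance_cone_def)
    then have "\<not> a x v > 0" using dominance_cone_nonneg[OF assms u(2)] by simp
    then show "v \<in> {tv_zero}" using dominance_cone_pos[OF assms u(1)] by blast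
  next
    fix v :: "('m,'n) tvec" assume "v \<in> {tv_zero}"
    moreover have "tv_zero = tv_scale (-1) (tv_zero :: ('m,'n) tvec)" by (simp add: tv_scale_def tv_zero_def)
    ultimately show "v \<in> dominance_cone \<rho> x \<inter> tv_scale (- 1) ` dominance_cone \<rho> x" using zero_in_dominance_cone by blast
  qed
qed

lemma dominance_cone_mono: "\<rho> > 0 \<Longrightarrow> \<rho> \<le> \<rho>' \<Longrightarrow> dominance_cone \<rho> x \<subseteq> dominance_cone \<rho>' x"
proof
  fix v assume h: "\<rho> > 0" "\<rho> \<le> \<rho>'" "v \<in> dominance_cone \<rho> x"
  have "\<rho> * a x v \<le> \<rho>' * a x v" using h dominance_cone_nonneg by (intro mult_right_mono) auto
  then show "v \<in> dominance_cone \<rho>' x" using h by (force simp: dominance_cone_def)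
qed

text \<open>
  The cone of aperture \<open>exp (- \<mu>)\<close> serves as the inner cone field, reached from time \<open>1\<close> on.  Its
  nonzero vectors are interior to the outer cone because \<open>a > 0\<close> on them.
\<close>
lemma strictly_positive: "strictly_differentially_positive A \<psi> (dominance_cone 1)"
  unfolding strictly_differentially_positive_def differentially_positive_def
proof (intro conjI allI impI)
  show "cone_field A (dominance_cone 1)" by (rule cone_field_dominance_cone) simp
  fix x and t :: real assume t: "t > 0"
  then have "exp (- \<mu> * t) \<le> 1" using \<mu>_pos by simp
  then show "tangent_map A (\<psi> t) x ` dominance_cone 1 x \<subseteq> dominance_cone 1 (\<psi> t x)"
    using dominance_cone_flow dominance_cone_mono[of "exp (- \<mu> * t)" 1] t by fastforce
next
  show "\<exists>T>0. \<exists>R. cone_field A R \<and>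
      (\<forall>x. R x \<subseteq> tv_interior A x (dominance_cone 1 x) \<union> {tv_zero}) \<and>
      (\<forall>x. \<forall>t\<ge>T. tangent_map A (\<psi> t) x ` dominance_cone 1 x \<subseteq> R (\<psi> t x))"
  proof (intro exI[of _ "1::real"] exI[of _ "dominance_cone (exp (- \<mu>))"] conjI allI impI)
    show "cone_field A (dominance_cone (exp (- \<mu>)))" by (rule cone_field_dominance_cone) simp
    show "dominance_cone (exp (- \<mu>)) x \<subseteq> tv_interior A x (dominance_cone 1 x) \<union> {tv_zero}" for x
    proof
      fix v assume v: "v \<in> dominance_cone (exp (- \<mu>)) x"
      show "v \<in> tv_interior A x (dominance_cone 1 x) \<union> {tv_zero}"
      proof (cases "v = tv_zero")
        case False
        have "exp (- \<mu>) * a x v < 1 * a x v"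
          using dominance_cone_pos[OF _ v False] \<mu>_pos by (intro mult_strict_right_mono) auto
        then have "v \<in> tv_interior A x (dominance_cone 1 x)"
          using v by (intro strict_dominance_cone_interior) (auto simp: dominance_cone_def)
        then show ?thesis by blast
      qed simp
    qed
    fix x and t :: real assume t: "t \<ge> 1"
    then have "exp (- \<mu> * t) \<le> exp (- \<mu>)" using \<mu>_pos by simp
    then show "tangent_map A (\<psi> t) x ` dominance_cone 1 x \<subseteq> dominance_cone (exp (- \<mu>)) (\<psi> t x)"
      using dominance_cone_flow dominance_cone_mono[of "exp (- \<mu> * t)" "exp (- \<mu>)"] t by fastforce
  qed simp
qed

context
  fixes g :: "'m \<Rightarrow> ('m, 'n) tvec \<Rightarrow> ('m, 'n) tvec \<Rightarrow> real"
  assumes metric: "riemannian_metric A g"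
begin

definition unit_dominant :: "'m \<Rightarrow> ('m, 'n) tvec" where
  "unit_dominant x = tv_scale (1 / tv_norm g x (dominant x)) (dominant x)"

lemma dominant_nonzero: "dominant x \<noteq> tv_zero"
proof
  assume 0: "dominant x = tv_zero"
  then have "tv_scale 0 (dominant x) = dominant x" by (simp add: tv_scale_def tv_zero_def)
  then show False using a_scale[OF dominant(1), of x 0] dominant(2)[of x] by simp
qed

lemma norm_dominant: "tv_norm g x (dominant x) > 0"
  by (rule tv_norm_pos[OF atlas metric dominant(1) dominant_nonzero])

lemma unit_dominant: "unit_dominant x \<in> tangent_space A x" "a x (unit_dominant x) > 0" "j \<in> {2..CARD('n)} \<Longrightarrow> b j x (unit_dominant x) = 0"
  "tv_norm g x (unit_dominant x) = 1"
  using norm_dominant[of x]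
  by (simp_all add: unit_dominant_def tv_scale_in[OF atlas dominant(1)] a_scale[OF dominant(1)] b_scale[OF _ dominant(1)] dominant
      tv_norm_scale[OF atlas metric dominant(1)])

text \<open>
  The norm of a vector is controlled by its values under \<open>a\<close> and the \<open>d (\<phi> j)\<close>.  So \<open>u t\<close>, scaled to
  \<open>a = 1\<close>, is within a multiple of \<open>exp (- \<mu> * t)\<close> of \<open>dominant x\<close>, and normalization to unit length
  does not see the scaling by positive numbers.
\<close>
lemma normalized_push_tendsto:
  assumes T: "\<And>t. u t \<in> tangent_space A x"
    and pos: "\<forall>\<^sub>F t in at_top. a x (u t) > 0"
    and small: "\<And>j. j \<in> {2..CARD('n)} \<Longrightarrow> \<forall>\<^sub>F t in at_top. cmod (b j x (u t)) \<le> exp (- \<mu> * t) * a x (u t)"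
  shows "((\<lambda>t. tv_scale (1 / tv_norm g x (u t)) (u t)) \<longlongrightarrow> unit_dominant x) at_top"
proof -
  let ?c = "chart_at A x"
  let ?N = "\<lambda>q. tv_norm g x (E x q)"
  define q where "q t = (1 / a x (u t)) *\<^sub>R u t ?c" for t
  define l where "l = dominant x ?c"
  have El: "E x l = dominant x" by (simp add: l_def E_of dominant)
  have Eq: "E x (q t) = tv_scale (1 / a x (u t)) (u t)" for t
    using tv_scale_E[OF T] by (simp add: q_def)
  obtain B where B: "B > 0" "\<And>v. norm v \<le> B * (\<bar>a x (E x v)\<bar> + (\<Sum>j\<in>{2..CARD('n)}. cmod (b j x (E x v))))"
    using norm_bound by blast
  have all_small: "\<forall>\<^sub>F t in at_top. \<forall>j\<in>{2..CARD('n)}. cmod (b j x (u t)) \<le> exp (- \<mu> * t) * a x (u t)"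
    using small by (simp add: eventually_ball_finite)
  have "((\<lambda>t. q t - l) \<longlongrightarrow> 0) at_top"
  proof (rule Lim_null_comparison)
    show "\<forall>\<^sub>F t in at_top. norm (q t - l) \<le> B * (real (card {2..CARD('n)}) * exp (- \<mu> * t))"
      using pos all_small
    proof eventually_elim
      case (elim t)
      have "a x (E x (q t - l)) = 0"
        using elim(1) linear_diff[OF linear_a, of x "q t" l]
        by (simp add: Eq El a_scale[OF T] dominant)
      moreover have "cmod (b j x (E x (q t - l))) \<le> exp (- \<mu> * t)" if j: "j \<in> {2..CARD('n)}" for j
      proof -
        have "b j x (E x (q t - l)) = (1 / a x (u t)) *\<^sub>R b j x (u t)"
          using linear_diff[OF linear_b[OF tail_in[OF j]], of x "q t" l]
          by (simp add: Eq El b_scale[OF j T] dominant(3)[OF j])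
        then show ?thesis using elim j by (simp add: field_simps)
      qed
      then have "(\<Sum>j\<in>{2..CARD('n)}. cmod (b j x (E x (q t - l)))) \<le> real (card {2..CARD('n)}) * exp (- \<mu> * t)"
        by (rule sum_bounded_above)
      ultimately have "\<bar>a x (E x (q t - l))\<bar> + (\<Sum>j\<in>{2..CARD('n)}. cmod (b j x (E x (q t - l))))
          \<le> real (card {2..CARD('n)}) * exp (- \<mu> * t)" by simp
      then show ?case
        using B(2)[of "q t - l"] mult_left_mono[OF _ less_imp_le[OF B(1)]] by (blast intro: order_trans)
    qed
    have "((\<lambda>t. B * (real (card {2..CARD('n)}) * exp (- \<mu> * t))) \<longlongrightarrow> B * (real (card {2..CARD('n)}) * 0)) at_top"
      by (intro tendsto_intros exp_decay)
    then show "((\<lambda>t. B * (real (card {2..CARD('n)}) * exp (- \<mu> * t))) \<longlongrightarrow> 0) at_top" by simp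
  qed
  then have q_lim: "(q \<longlongrightarrow> l) at_top" by (simp add: LIM_zero_iff)
  have "isCont ?N l"
    using continuous_tv_norm[OF atlas metric chart] by (simp add: continuous_on_eq_continuous_at)
  then have "((\<lambda>t. ?N (q t)) \<longlongrightarrow> ?N l) at_top" using q_lim by (rule isCont_tendsto_compose)
  then have "((\<lambda>t. (1 / ?N (q t)) *\<^sub>R q t) \<longlongrightarrow> (1 / ?N l) *\<^sub>R l) at_top"
    using q_lim norm_dominant[of x] by (intro tendsto_intros) (auto simp: El)
  moreover have "isCont (E x) ((1 / ?N l) *\<^sub>R l)"
    using continuous_tv_of_coords[OF atlas chart, of x] by (simp add: continuous_on_eq_continuous_at)
  ultimately have "((\<lambda>t. E x ((1 / ?N (q t)) *\<^sub>R q t)) \<longlongrightarrow> E x ((1 / ?N l) *\<^sub>R l)) at_top"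
    by (rule isCont_tendsto_compose[rotated])
  moreover have "E x ((1 / ?N l) *\<^sub>R l) = unit_dominant x"
    by (simp add: E_linear El unit_dominant_def)
  moreover have "\<forall>\<^sub>F t in at_top. E x ((1 / ?N (q t)) *\<^sub>R q t) = tv_scale (1 / tv_norm g x (u t)) (u t)"
    using pos
  proof eventually_elim
    case (elim t)
    have "?N (q t) = tv_norm g x (u t) / a x (u t)"
      using elim by (simp add: Eq tv_norm_scale[OF atlas metric T])
    then show ?case
      using elim by (simp add: E_linear Eq tv_scale_def)
  qed
  ultimately show ?thesis by (simp add: tendsto_cong)
qed

lemma perron_frobenius_unit_dominant: "perron_frobenius_field A g \<psi> (dominance_cone 1) unit_dominant"
  unfolding perron_frobenius_field_def
proof (intro conjI allI impI)
  show "unit_dominant x \<in> tv_interior A x (dominance_cone 1 x)" for x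
    using unit_dominant by (intro strict_dominance_cone_interior) simp_all
  fix x and \<delta> :: "real \<Rightarrow> ('m,'n) tvec"
  assume \<delta>: "\<forall>t>0. \<delta> t \<in> dominance_cone 1 (\<psi> (- t) x) - {tv_zero}"
  \<comment> \<open>For \<open>t \<le> 0\<close> nothing is known about \<open>\<delta> t\<close>; the value zero keeps \<open>u t\<close> tangent.\<close>
  define u where "u t = (if t > 0 then tangent_map A (\<psi> t) (\<psi> (- t) x) (\<delta> t) else tv_zero)" for t
  have u: "u t \<in> dominance_cone (exp (- \<mu> * t)) x" "a x (u t) > 0" if "t > 0" for t
  proof -
    have "\<psi> t (\<psi> (- t) x) = x" by (simp add: flow_group flow_zero)
    then show "u t \<in> dominance_cone (exp (- \<mu> * t)) x" "a x (u t) > 0"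
      using dominance_cone_flow[of "\<delta> t" "\<psi> (- t) x" t] flow_tangent_nonzero[of "\<delta> t" "\<psi> (- t) x" t] \<delta> that
      by (auto simp: u_def)
  qed
  have "((\<lambda>t. tv_scale (1 / tv_norm g x (u t)) (u t)) \<longlongrightarrow> unit_dominant x) at_top"
  proof (rule normalized_push_tendsto)
    show "u t \<in> tangent_space A x" for t
      using u(1)[of t] tv_zero_in[OF atlas] by (cases "t > 0") (auto simp: dominance_cone_def u_def)
    show "\<forall>\<^sub>F t in at_top. a x (u t) > 0"
      using eventually_gt_at_top[of 0] by eventually_elim (rule u(2))
    show "\<forall>\<^sub>F t in at_top. cmod (b j x (u t)) \<le> exp (- \<mu> * t) * a x (u t)" if "j \<in> {2..CARD('n)}" for j
      using eventually_gt_at_top[of 0] by eventually_elim (use u(1) that in \<open>auto simp: dominance_cone_def\<close>)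
  qed
  moreover have "\<forall>\<^sub>F t in at_top. tv_scale (1 / tv_norm g x (u t)) (u t) =
      (let u = tangent_map A (\<psi> t) (\<psi> (- t) x) (\<delta> t) in tv_scale (1 / tv_norm g x u) u)"
    using eventually_gt_at_top[of 0] by eventually_elim (simp add: u_def Let_def)
  ultimately show "((\<lambda>t. let u = tangent_map A (\<psi> t) (\<psi> (- t) x) (\<delta> t)
      in tv_scale (1 / tv_norm g x u) u) \<longlongrightarrow> unit_dominant x) at_top"
    by (rule Lim_transform_eventually)
qed

lemma perron_frobenius_unique:
  assumes w: "perron_frobenius_field A g \<psi> (dominance_cone 1) w"
  shows "w = unit_dominant"
proof
  fix x
  have "\<exists>v. v \<in> dominance_cone 1 (\<psi> (- t) x) - {tv_zero}" for t using dominance_cone_nonzero_exists by blast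
  then obtain \<delta> where \<delta>: "\<And>t. \<delta> t \<in> dominance_cone 1 (\<psi> (- t) x) - {tv_zero}" by metis
  define U where "U t = (let u = tangent_map A (\<psi> t) (\<psi> (- t) x) (\<delta> t) in tv_scale (1 / tv_norm g x u) u)" for t
  have limits: "(U \<longlongrightarrow> w x) at_top" "(U \<longlongrightarrow> unit_dominant x) at_top"
    using w perron_frobenius_unit_dominant \<delta> unfolding perron_frobenius_field_def U_def by blast+
  show "w x = unit_dominant x"
  proof
    fix c
    have "((\<lambda>t. U t c) \<longlongrightarrow> w x c) at_top" "((\<lambda>t. U t c) \<longlongrightarrow> unit_dominant x c) at_top"
      by (rule continuous_on_tendsto_compose[OF continuous_on_product_coordinates[of c]];
          simp add: limits)+
    then show "w x c = unit_dominant x c" by (rule tendsto_unique[OF trivial_limit_at_top_linorder])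
  qed
qed

lemma unit_annihilated_unit_dominant: "unit_annihilated_field A g \<phi> unit_dominant"
  by (simp add: unit_annihilated_field_def vector_field_def unit_dominant)

lemma unit_annihilated_sign:
  assumes v: "unit_annihilated_field A g \<phi> v"
  shows "v x = unit_dominant x \<or> v x = tv_scale (-1) (unit_dominant x)" "a x (v x) \<ge> 0 \<Longrightarrow> v x = unit_dominant x"
proof -
  have vT: "v x \<in> tangent_space A x" and unit: "tv_norm g x (v x) = 1" and "\<And>j. j \<in> {2..CARD('n)} \<Longrightarrow> b j x (v x) = 0"
    using v by (simp_all add: unit_annihilated_field_def vector_field_def)
  then have mult: "v x = tv_scale (a x (v x)) (dominant x)" by (intro annihilated_imp_multiple)
  then have "\<bar>a x (v x)\<bar> * tv_norm g x (dominant x) = 1"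
    using unit tv_norm_scale[OF atlas metric dominant(1)] by metis
  then have abs: "\<bar>a x (v x)\<bar> = 1 / tv_norm g x (dominant x)"
    using norm_dominant[of x] by (simp add: field_simps)
  show pos: "v x = unit_dominant x" if "a x (v x) \<ge> 0" using mult abs that by (simp add: unit_dominant_def)
  have neg: "v x = tv_scale (-1) (unit_dominant x)" if "a x (v x) < 0"
  proof -
    have "a x (v x) = - (1 / tv_norm g x (dominant x))" using abs that by simp
    then show ?thesis using mult by (simp add: unit_dominant_def tv_scale_def)
  qed
  show "v x = unit_dominant x \<or> v x = tv_scale (-1) (unit_dominant x)" using pos neg by linarith
qed

theorem perron_frobenius_characterization:
  assumes K: "K = eigenfunction_cone A \<phi> a"
  shows "strictly_differentially_positive A \<psi> K \<and>
         (\<exists>!w. perron_frobenius_field A g \<psi> K w) \<and>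
         (\<forall>w. perron_frobenius_field A g \<psi> K w \<longrightarrow>
            unit_annihilated_field A g \<phi> w \<and>
            (\<forall>v. unit_annihilated_field A g \<phi> v \<and> (\<forall>x. v x \<in> K x) \<longrightarrow> v = w) \<and>
            (\<forall>v. unit_annihilated_field A g \<phi> v \<longrightarrow>
               (\<forall>x. v x = w x \<or> v x = tv_scale (-1) (w x))))"
proof -
  have K1: "K = dominance_cone 1" by (simp only: K dominance_cone_one)
  have "v = unit_dominant" if v: "unit_annihilated_field A g \<phi> v" "\<forall>x. v x \<in> dominance_cone 1 x" for v
    using unit_annihilated_sign(2)[OF v(1)] dominance_cone_nonneg[of 1] v(2) by (auto simp: fun_eq_iff)
  then show ?thesis
    unfolding K1
    using strictly_positive perron_frobenius_unit_dominant perron_frobenius_unique unit_annihilated_unit_dominant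
      unit_annihilated_sign(1) by blast
qed

end
end

section \<open>Real eigenfunctions and eigenfunctions of constant modulus\<close>

text \<open>The imaginary part of \<open>h\<close> vanishes identically, hence so does its derivative.\<close>
lemma real_valued_differential:
  fixes A :: "('m::{t2_space, second_countable_topology}, 'n::finite) chart set"
  assumes atlas: "smooth_atlas A" and h: "Ck_observable A 1 UNIV h" and real: "\<And>x. h x \<in> \<real>"
    and v: "v \<in> tangent_space A x"
  shows "of_real (Re (differential A h x v)) = differential A h x v"
proof -
  let ?c = "chart_at A x"
  let ?h' = "\<lambda>u. differential A h x (tv_of_coords A ?c x u)"
  note c = chart_at_in[OF atlas, of x]
  have "((\<lambda>p. Im ((h \<circ> cinv ?c) p)) has_derivative (\<lambda>u. Im (?h' u))) (at (cmap ?c x))"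
    by (rule bounded_linear.has_derivative[OF bounded_linear_Im Ck_observable_has_derivative[OF atlas h UNIV_I c]])
  moreover have "(\<lambda>p. Im ((h \<circ> cinv ?c) p)) = (\<lambda>p. 0)"
    using real by (simp add: complex_is_Real_iff fun_eq_iff)
  ultimately have "(\<lambda>u. Im (?h' u)) = (\<lambda>u. 0)"
    using has_derivative_unique has_derivative_const by metis
  then have "Im (?h' (v ?c)) = 0" by (rule fun_cong)
  then show ?thesis by (simp add: tv_of_coords_of[OF atlas c v] complex_eq_iff)
qed

text \<open>Differentiate \<open>h = r * exp (\<i> * \<theta>)\<close> with constant \<open>r\<close>.\<close>
lemma differential_angle_lift:
  fixes A :: "('m::{t2_space, second_countable_topology}, 'n::finite) chart set"
  assumes atlas: "smooth_atlas A" and lift: "C1_angle_lift A h U \<theta>" and "x \<in> U"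
    and modulus: "\<And>y. cmod (h y) = r" and v: "v \<in> tangent_space A x"
  shows "differential A h x v = of_real (differential A \<theta> x v) * (\<i> * h x)"
proof -
  let ?c = "chart_at A x"
  let ?\<theta>' = "\<lambda>u. differential A \<theta> x (tv_of_coords A ?c x u)"
  note c = chart_at_in[OF atlas, of x]
  have U: "open U" "Ck_observable A 1 U \<theta>" "\<And>y. y \<in> U \<Longrightarrow> h y = of_real r * exp (\<i> * of_real (\<theta> y))"
    using lift modulus by (auto simp: C1_angle_lift_def cis_conv_exp)
  have "((\<lambda>p. \<i> * of_real ((\<theta> \<circ> cinv ?c) p)) has_derivative (\<lambda>u. \<i> * of_real (?\<theta>' u))) (at (cmap ?c x))"
    by (intro has_derivative_mult_right has_derivative_of_real Ck_observable_has_derivative[OF atlas U(2) \<open>x \<in> U\<close> c])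
  moreover have "(exp has_derivative (*) (exp (\<i> * of_real (\<theta> x)))) (at (\<i> * of_real ((\<theta> \<circ> cinv ?c) (cmap ?c x))))"
    using DERIV_exp[of "\<i> * of_real (\<theta> x)"] by (simp add: has_field_derivative_def cinv_cmap[OF atlas c])
  ultimately have "((\<lambda>p. exp (\<i> * of_real ((\<theta> \<circ> cinv ?c) p))) has_derivative
      (\<lambda>u. exp (\<i> * of_real (\<theta> x)) * (\<i> * of_real (?\<theta>' u)))) (at (cmap ?c x))"
    by (rule has_derivative_compose)
  then have "((\<lambda>p. of_real r * exp (\<i> * of_real ((\<theta> \<circ> cinv ?c) p))) has_derivative
      (\<lambda>u. of_real r * (exp (\<i> * of_real (\<theta> x)) * (\<i> * of_real (?\<theta>' u))))) (at (cmap ?c x))"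
    by (rule has_derivative_mult_right)
  moreover have "\<forall>\<^sub>F p in nhds (cmap ?c x). of_real r * exp (\<i> * of_real ((\<theta> \<circ> cinv ?c) p)) = (h \<circ> cinv ?c) p"
  proof -
    have "\<forall>\<^sub>F p in nhds (cmap ?c x). cinv ?c p \<in> U"
      using topological_tendstoD[OF isCont_cinv[OF atlas c, unfolded isCont_iff_tendsto_nhds] U(1)] \<open>x \<in> U\<close>
      by (simp add: cinv_cmap[OF atlas c])
    then show ?thesis by eventually_elim (simp add: U(3))
  qed
  ultimately have "((h \<circ> cinv ?c) has_derivative
      (\<lambda>u. of_real r * (exp (\<i> * of_real (\<theta> x)) * (\<i> * of_real (?\<theta>' u))))) (at (cmap ?c x))"
    by (rule has_derivative_transform_eventually_nhds)
  from differential_eq[OF atlas c this v] show ?thesis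
    by (simp add: tv_of_coords_of[OF atlas c v] U(3)[OF \<open>x \<in> U\<close>])
qed

text \<open>
  By the previous lemma the differential of a local lift is determined by that of \<open>h\<close>, as
  \<open>h x \<noteq> 0\<close>; so the definite description is well defined.
\<close>
lemma differential_eq_angle_differential:
  fixes A :: "('m::{t2_space, second_countable_topology}, 'n::finite) chart set"
  assumes atlas: "smooth_atlas A" and angle: "C1_angle A h"
    and modulus: "\<And>y. cmod (h y) = r" and v: "v \<in> tangent_space A x"
  shows "differential A h x v = of_real (angle_differential A h x v) * (\<i> * h x)"
proof -
  let ?P = "\<lambda>s. \<exists>U \<theta>. x \<in> U \<and> C1_angle_lift A h U \<theta> \<and> s = differential A \<theta> x v"
  have P: "differential A h x v = of_real s * (\<i> * h x)" if s: "?P s" for s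
  proof -
    obtain U \<theta> where \<theta>: "x \<in> U" "C1_angle_lift A h U \<theta>" "s = differential A \<theta> x v"
      using s by blast
    show ?thesis
      unfolding \<theta>(3) by (rule differential_angle_lift[OF atlas \<theta>(2,1) modulus v])
  qed
  have "h x \<noteq> 0" and "\<exists>s. ?P s" using angle unfolding C1_angle_def by blast+
  then obtain s where s: "?P s" by blast
  have "s' = s" if "?P s'" for s'
    using P[OF that] P[OF s] \<open>h x \<noteq> 0\<close> by simp
  then have "angle_differential A h x v = s"
    unfolding angle_differential_def using s by (intro the_equality)
  then show ?thesis using P[OF s] by simp
qed

section \<open>The Perron-Frobenius field of a system with a dominant eigenfunction\<close>

theorem proposition2:
  fixes A :: "('m::{t2_space, second_countable_topology}, 'n::finite) chart set"
    and g :: "'m \<Rightarrow> ('m, 'n) tvec \<Rightarrow> ('m, 'n) tvec \<Rightarrow> real"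
    and f :: "'m \<Rightarrow> ('m, 'n) tvec"
    and \<psi> :: "real \<Rightarrow> 'm \<Rightarrow> 'm"
    and \<phi> :: "nat \<Rightarrow> 'm \<Rightarrow> complex"
    and lam :: "nat \<Rightarrow> complex"
    and K :: "'m \<Rightarrow> ('m, 'n) tvec set"
  assumes "smooth_atlas A"
    and "riemannian_metric A g"
    and "Ck_vector_field A 2 f"
    and "complete_flow A f \<psi>"
    and "\<forall>j\<in>{1..CARD('n)}. Ck_observable A 1 UNIV (\<phi> j) \<and> koopman_eigenfunction \<psi> (lam j) (\<phi> j)"
    and "\<forall>j\<in>{2..CARD('n)}. Re (lam 1) > Re (lam j)"
    and "\<forall>x. inj_on (\<lambda>v. \<lambda>j\<in>{1..CARD('n)}. differential A (\<phi> j) x v) (tangent_space A x)"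
    and "(lam 1 \<in> \<real> \<and> (\<forall>x. \<phi> 1 x \<in> \<real>) \<and>
            K = eigenfunction_cone A \<phi> (\<lambda>x v. Re (differential A (\<phi> 1) x v)))
         \<or> (Re (lam 1) = 0 \<and> C1_angle A (\<phi> 1) \<and> (\<exists>r. \<forall>x. cmod (\<phi> 1 x) = r) \<and>
            K = eigenfunction_cone A \<phi> (angle_differential A (\<phi> 1)))"
    and "cone_field A K"
  shows "strictly_differentially_positive A \<psi> K \<and>
         (\<exists>!w. perron_frobenius_field A g \<psi> K w) \<and>
         (\<forall>w. perron_frobenius_field A g \<psi> K w \<longrightarrow>
            unit_annihilated_field A g \<phi> w \<and>
            (\<forall>v. unit_annihilated_field A g \<phi> v \<and> (\<forall>x. v x \<in> K x) \<longrightarrow> v = w) \<and>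
            (\<forall>v. unit_annihilated_field A g \<phi> v \<longrightarrow>
               (\<forall>x. v x = w x \<or> v x = tv_scale (-1) (w x))))"
proof -
  have eigen: "\<phi> j (\<psi> t x) = exp (lam j * of_real t) * \<phi> j x" if "j \<in> {1..CARD('n)}" for j t x
    using assms(5) that by (simp add: koopman_eigenfunction_def koopman_def)
  interpret koopman_immersion A \<psi> \<phi> lam
    by unfold_locales (use assms(1,4,5,7) eigen in \<open>auto simp: complete_flow_def\<close>)
  have one: "1 \<in> {1..CARD('n)}" by (simp add: Suc_le_eq)
  from assms(8) show ?thesis
  proof (elim disjE conjE exE)
    assume real: "lam 1 \<in> \<real>" "\<forall>x. \<phi> 1 x \<in> \<real>"
      and K: "K = eigenfunction_cone A \<phi> (\<lambda>x v. Re (differential A (\<phi> 1) x v))"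
    have exp_growth: "exp (lam 1 * of_real t) = of_real (exp (Re (lam 1) * t))" for t
      using real(1) by (simp add: exp_of_real[symmetric] complex_is_Real_iff complex_eq_iff)
    interpret dominated_immersion A \<psi> \<phi> lam "\<lambda>x v. Re (differential A (\<phi> 1) x v)" "\<lambda>x. 1"
      by unfold_locales
        (use assms(6,9) K exp_growth real_valued_differential[OF assms(1) C1[OF one]] real(2) in auto)
    show ?thesis by (rule perron_frobenius_characterization[OF assms(2) K])
  next
    fix r
    assume angle: "Re (lam 1) = 0" "C1_angle A (\<phi> 1)" "\<forall>x. cmod (\<phi> 1 x) = r"
      and K: "K = eigenfunction_cone A \<phi> (angle_differential A (\<phi> 1))"
    have nonzero: "\<phi> 1 x \<noteq> 0" for x using angle(2) by (simp add: C1_angle_def)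
    interpret dominated_immersion A \<psi> \<phi> lam "angle_differential A (\<phi> 1)" "\<lambda>x. \<i> * \<phi> 1 x"
      by unfold_locales
        (use assms(6,9) K nonzero angle(1) eigen[OF one] angle(3)
           differential_eq_angle_differential[OF assms(1) angle(2)] in auto)
    show ?thesis by (rule perron_frobenius_characterization[OF assms(2) K])
  qed
qed

end
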